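(* Let $p$ be a prime, $G$ a pro-$p$ group, and $1\to R\to S\to G\to 1$ a minimal presentation of $G$ ($S$ a free pro-$p$ group whose minimal generating set maps to a minimal generating set of $G$). Let $\iota:\mathrm{gr}(R,S)\to\mathrm{gr}(R)_{ind}$ be the homomorphism defined below. The following are equivalent: (A) $R^{(n,S)}=R\cap S^{(n+1)}$ for all $n\ge 1$; (B) $\iota$ is injective; (C) $\iota$ is surjective.
   Context: For a pro-$p$ group $H$, $H^{(1)}=H$, $H^{(n+1)}=(H^{(n)})^p[H^{(n)},H]$ (closed subgroup generated). $R^{(1,S)}=R$, $R^{(n+1,S)}=(R^{(n,S)})^p[R^{(n,S)},S]$; one has $R\subseteq S^{(2)}$ and $R^{(n,S)}\subseteq R\cap S^{(n+1)}$. Let $\mathrm{gr}_n(R,S)=R^{(n,S)}/R^{(n+1,S)}$ and $\mathrm{gr}_n(R)_{ind}=(R\cap S^{(n)})/(R\cap S^{(n+1)})$ (abelian groups, written additively), $\mathrm{gr}(R,S)=\bigoplus_{n\ge1}\mathrm{gr}_n(R,S)$, $\mathrm{gr}(R)_{ind}=\bigoplus_n\mathrm{gr}_n(R)_{ind}$. The map $\iota=\bigoplus_n\iota_n$, where $\iota_n:\mathrm{gr}_n(R,S)\to\mathrm{gr}_{n+1}(R)_{ind}$ is induced by the inclusions $R^{(n,S)}\subseteq R\cap S^{(n+1)}$ and $R^{(n+1,S)}\subseteq R\cap S^{(n+2)}$. *)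

theory Defs
  imports
    "HOL-Algebra.Product_Groups"
    "HOL-Analysis.Abstract_Topological_Spaces"
    "HOL-Computational_Algebra.Primes"
begin

definition topological_group :: "'a monoid \<Rightarrow> 'a topology \<Rightarrow> bool" where
  "topological_group G T \<longleftrightarrow>
     group G \<and> topspace T = carrier G \<and>
     continuous_map (prod_topology T T) T (\<lambda>(x, y). x \<otimes>\<^bsub>G\<^esub> y) \<and>
     continuous_map T T (\<lambda>x. inv\<^bsub>G\<^esub> x)"

definition profinite_group :: "'a monoid \<Rightarrow> 'a topology \<Rightarrow> bool" where
  "profinite_group G T \<longleftrightarrow>
     topological_group G T \<and> compact_space T \<and> Hausdorff_space T \<and>
     (\<forall>V. openin T V \<and> \<one>\<^bsub>G\<^esub> \<in> V \<longrightarrow> (\<exists>U. subgroup U G \<and> openin T U \<and> U \<subseteq> V))"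

text \<open>As \<^const>\<open>card\<close> of an infinite set is \<open>0\<close>, the index condition forces finite index
  (for \<open>p > 0\<close>).\<close>

definition pro_p_group :: "nat \<Rightarrow> 'a monoid \<Rightarrow> 'a topology \<Rightarrow> bool" where
  "pro_p_group p G T \<longleftrightarrow>
     profinite_group G T \<and>
     (\<forall>U. U \<lhd> G \<and> openin T U \<longrightarrow> (\<exists>k. card (rcosets\<^bsub>G\<^esub> U) = p ^ k))"

definition closed_subgroup_generated :: "'a monoid \<Rightarrow> 'a topology \<Rightarrow> 'a set \<Rightarrow> 'a set" where
  "closed_subgroup_generated G T A = \<Inter>{H. subgroup H G \<and> closedin T H \<and> A \<subseteq> H}"

text \<open>A family \<open>f\<close> indexed by \<open>X\<close> converges to \<open>1\<close> if every open subgroup contains all but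
  finitely many of its members.\<close>

definition converges_to_one ::
    "'a monoid \<Rightarrow> 'a topology \<Rightarrow> 'x set \<Rightarrow> ('x \<Rightarrow> 'a) \<Rightarrow> bool" where
  "converges_to_one G T X f \<longleftrightarrow>
     (\<forall>U. subgroup U G \<and> openin T U \<longrightarrow> finite {x \<in> X. f x \<notin> U})"

text \<open>Generating sets of profinite groups are, as usual, topological generating sets that
  converge to \<open>1\<close>; the latter is automatic for finite sets.\<close>

definition generating_set :: "'a monoid \<Rightarrow> 'a topology \<Rightarrow> 'a set \<Rightarrow> bool" where
  "generating_set G T X \<longleftrightarrow>
     X \<subseteq> carrier G \<and> converges_to_one G T X (\<lambda>x. x) \<and>
     closed_subgroup_generated G T X = carrier G"

definition minimal_generating_set :: "'a monoid \<Rightarrow> 'a topology \<Rightarrow> 'a set \<Rightarrow> bool" where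
  "minimal_generating_set G T X \<longleftrightarrow>
     generating_set G T X \<and> (\<forall>Y. Y \<subset> X \<longrightarrow> \<not> generating_set G T Y)"

text \<open>The universal property of the free pro-\<open>p\<close> group on a set \<open>X\<close> converging to \<open>1\<close>.
  HOL cannot quantify over types inside a definition, so the test groups \<open>H\<close> live on the type
  \<open>'s \<times> nat\<close>. This loses nothing: every finite \<open>p\<close>-group has an isomorphic copy on this type,
  and the universal property for finite \<open>p\<close>-groups yields the one for arbitrary pro-\<open>p\<close> groups
  by passing to inverse limits.\<close>

definition free_pro_p_on :: "nat \<Rightarrow> 's monoid \<Rightarrow> 's topology \<Rightarrow> 's set \<Rightarrow> bool" where
  "free_pro_p_on p S T X \<longleftrightarrow>
     pro_p_group p S T \<and> X \<subseteq> carrier S \<and> converges_to_one S T X (\<lambda>x. x) \<and>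
     (\<forall>(H :: ('s \<times> nat) monoid) TH f.
        pro_p_group p H TH \<and> f \<in> X \<rightarrow> carrier H \<and> converges_to_one H TH X f \<longrightarrow>
        (\<exists>!\<phi>. \<phi> \<in> extensional (carrier S) \<and> \<phi> \<in> hom S H \<and> continuous_map T TH \<phi> \<and>
              (\<forall>x\<in>X. \<phi> x = f x)))"

definition free_pro_p_group :: "nat \<Rightarrow> 's monoid \<Rightarrow> 's topology \<Rightarrow> bool" where
  "free_pro_p_group p S T \<longleftrightarrow> (\<exists>X. free_pro_p_on p S T X)"

text \<open>\<open>1 \<rightarrow> R \<rightarrow> S \<rightarrow> G \<rightarrow> 1\<close> with \<open>R\<close> regarded as a subgroup of \<open>S\<close>. A minimal generating set of
  \<open>S\<close> is carried bijectively to one of \<open>G\<close>: without injectivity, two free generators with the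
  same image would be allowed.\<close>

definition minimal_presentation ::
    "nat \<Rightarrow> 's set \<Rightarrow> 's monoid \<Rightarrow> 's topology \<Rightarrow> ('s \<Rightarrow> 'g) \<Rightarrow> 'g monoid \<Rightarrow> 'g topology \<Rightarrow> bool"
  where
  "minimal_presentation p R S TS \<pi> G TG \<longleftrightarrow>
     free_pro_p_group p S TS \<and>
     \<pi> \<in> hom S G \<and> continuous_map TS TG \<pi> \<and> \<pi> ` carrier S = carrier G \<and> R = kernel S G \<pi> \<and>
     (\<exists>X. minimal_generating_set S TS X \<and> inj_on \<pi> X \<and> minimal_generating_set G TG (\<pi> ` X))"

text \<open>\<open>A \<mapsto> A\<^sup>p[A,S]\<close>.\<close>

definition p_central_step :: "nat \<Rightarrow> 's monoid \<Rightarrow> 's topology \<Rightarrow> 's set \<Rightarrow> 's set" where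
  "p_central_step p S T A = closed_subgroup_generated S T
     ({x [^]\<^bsub>S\<^esub> p | x. x \<in> A} \<union>
      {x \<otimes>\<^bsub>S\<^esub> y \<otimes>\<^bsub>S\<^esub> inv\<^bsub>S\<^esub> x \<otimes>\<^bsub>S\<^esub> inv\<^bsub>S\<^esub> y | x y. x \<in> A \<and> y \<in> carrier S})"

text \<open>\<open>R\<^bsup>(n,S)\<^esup>\<close>, indexed from \<open>n = 1\<close>; the value at \<open>n = 0\<close> is not used.\<close>

definition rel_p_series :: "nat \<Rightarrow> 's set \<Rightarrow> 's monoid \<Rightarrow> 's topology \<Rightarrow> nat \<Rightarrow> 's set" where
  "rel_p_series p R S T n = (p_central_step p S T ^^ (n - 1)) R"

definition p_series :: "nat \<Rightarrow> 's monoid \<Rightarrow> 's topology \<Rightarrow> nat \<Rightarrow> 's set" where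
  "p_series p S T n = rel_p_series p (carrier S) S T n"

definition gr_rel_n :: "nat \<Rightarrow> 's set \<Rightarrow> 's monoid \<Rightarrow> 's topology \<Rightarrow> nat \<Rightarrow> 's set monoid" where
  "gr_rel_n p R S T n =
     (S\<lparr>carrier := rel_p_series p R S T n\<rparr>) Mod (rel_p_series p R S T (n + 1))"

definition gr_ind_n :: "nat \<Rightarrow> 's set \<Rightarrow> 's monoid \<Rightarrow> 's topology \<Rightarrow> nat \<Rightarrow> 's set monoid" where
  "gr_ind_n p R S T n =
     (S\<lparr>carrier := R \<inter> p_series p S T n\<rparr>) Mod (R \<inter> p_series p S T (n + 1))"

definition gr_rel :: "nat \<Rightarrow> 's set \<Rightarrow> 's monoid \<Rightarrow> 's topology \<Rightarrow> (nat \<Rightarrow> 's set) monoid" where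
  "gr_rel p R S T = sum_group {1..} (gr_rel_n p R S T)"

definition gr_ind :: "nat \<Rightarrow> 's set \<Rightarrow> 's monoid \<Rightarrow> 's topology \<Rightarrow> (nat \<Rightarrow> 's set) monoid" where
  "gr_ind p R S T = sum_group {1..} (gr_ind_n p R S T)"

text \<open>\<open>\<iota>\<^sub>n\<close> sends the coset of \<open>a\<close> modulo \<open>N = R\<^bsup>(n+1,S)\<^esup>\<close> to the coset of \<open>a\<close> modulo the larger
  group \<open>M = R \<inter> S\<^bsup>(n+2)\<^esup>\<close>; as a set the latter is the product of \<open>M\<close> with the former.\<close>

lemma (in group) set_mult_r_coset_larger:
  assumes "subgroup N G" "subgroup M G" "N \<subseteq> M" "a \<in> carrier G"
  shows "M <#> (N #> a) = M #> a"
proof -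
  have "M <#> (N #> a) = (M <#> N) #> a"
    using assms by (simp add: setmult_rcos_assoc subgroup.subset)
  also have "M <#> N = M"
  proof
    show "M <#> N \<subseteq> M"
      using assms by (auto simp: set_mult_def intro: subgroup.m_closed)
    show "M \<subseteq> M <#> N"
      using assms subgroup.one_closed[of N G] subgroup.mem_carrier[of M G]
      by (force simp: set_mult_def)
  qed
  finally show ?thesis .
qed

definition iota_n :: "nat \<Rightarrow> 's set \<Rightarrow> 's monoid \<Rightarrow> 's topology \<Rightarrow> nat \<Rightarrow> 's set \<Rightarrow> 's set" where
  "iota_n p R S T n C = (R \<inter> p_series p S T (n + 2)) <#>\<^bsub>S\<^esub> C"

text \<open>\<open>\<iota>\<close> raises degrees by one, so its component in degree \<open>1\<close> vanishes.\<close>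

definition iota ::
    "nat \<Rightarrow> 's set \<Rightarrow> 's monoid \<Rightarrow> 's topology \<Rightarrow> (nat \<Rightarrow> 's set) \<Rightarrow> (nat \<Rightarrow> 's set)" where
  "iota p R S T f =
     (\<lambda>m\<in>{1..}. if m = 1 then \<one>\<^bsub>gr_ind_n p R S T 1\<^esub> else iota_n p R S T (m - 1) (f (m - 1)))"

end

theory Submission
  imports Defs "HOL-Algebra.Zassenhaus" "HOL-Algebra.Multiplicative_Group"
begin

text \<open>
  Put \<open>R\<^sub>n = R\<^bsup>(n,S)\<^esup>\<close> and \<open>D\<^sub>n = R \<inter> S\<^bsup>(n+1)\<^esup>\<close>, so \<open>R\<^sub>n \<subseteq> D\<^sub>n\<close>. Minimality of the presentation gives
  \<open>R \<subseteq> S\<^bsup>(2)\<^esup>\<close>, i.e. \<open>R\<^sub>1 = D\<^sub>1\<close>: each \<open>\<pi> y\<close> with \<open>y \<in> X\<close> is separated from the other generators of \<open>G\<close>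
  by an open subgroup containing \<open>G\<^bsup>(2)\<^esup>\<close>, and the preimages of these subgroups all contain \<open>R\<close> while
  their intersection lies in \<open>S\<^bsup>(2)\<^esup>\<close>. Injectivity of \<open>\<iota>\<close> says \<open>R\<^sub>n \<inter> D\<^sub>n\<^sub>+\<^sub>1 = R\<^sub>n\<^sub>+\<^sub>1\<close>, so \<open>R\<^sub>n = D\<^sub>n\<close> propagates
  from \<open>n\<close> to \<open>n + 1\<close>. Surjectivity says \<open>D\<^sub>n = D\<^sub>n\<^sub>+\<^sub>1 R\<^sub>n\<close>, hence \<open>D\<^sub>n = D\<^sub>m R\<^sub>n\<close> for all \<open>m \<ge> n\<close>; since every open
  normal subgroup of a pro-\<open>p\<close> group contains some \<open>S\<^bsup>(m)\<^esup>\<close> (finite \<open>p\<close>-groups have nontrivial centre) and \<open>R\<^sub>n\<close>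
  is closed, \<open>D\<^sub>n = R\<^sub>n\<close>.
\<close>

section \<open>Central elements of order \<open>p\<close> modulo a normal subgroup\<close>

text \<open>For normal \<open>N\<close> this is the preimage of the elements of the centre of
  \<open>G/N\<close> whose order divides \<open>p\<close>. It is written with elements so that
  \<open>N\<close> may be any set: \<open>A \<subseteq> p_central_mod p G N\<close> says that
  \<open>A\<close> consists of group elements and \<open>N\<close> contains their
  \<open>p\<close>-th powers and their commutators with the group.\<close>

definition p_central_mod :: "nat \<Rightarrow> ('a, 'b) monoid_scheme \<Rightarrow> 'a set \<Rightarrow> 'a set" where
  "p_central_mod p G N = {x \<in> carrier G. x [^]\<^bsub>G\<^esub> p \<in> N \<and>
     (\<forall>y\<in>carrier G. x \<otimes>\<^bsub>G\<^esub> y \<otimes>\<^bsub>G\<^esub> inv\<^bsub>G\<^esub> x \<otimes>\<^bsub>G\<^esub> inv\<^bsub>G\<^esub> y \<in> N)}"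

lemma p_central_modD:
  assumes "x \<in> p_central_mod p G N"
  shows "x \<in> carrier G" "x [^]\<^bsub>G\<^esub> p \<in> N"
    "y \<in> carrier G \<Longrightarrow> x \<otimes>\<^bsub>G\<^esub> y \<otimes>\<^bsub>G\<^esub> inv\<^bsub>G\<^esub> x \<otimes>\<^bsub>G\<^esub> inv\<^bsub>G\<^esub> y \<in> N"
  using assms by (simp_all add: p_central_mod_def)

lemma (in group_hom) subgroup_vimage:
  assumes "subgroup K H"
  shows "subgroup {x \<in> carrier G. h x \<in> K} G"
proof -
  interpret K: subgroup K H by fact
  show ?thesis by unfold_locales auto
qed

lemma (in group) mult_inv_cancel_left:
  assumes "x \<in> carrier G" "y \<in> carrier G"
  shows "x \<otimes> (inv x \<otimes> y) = y" "inv x \<otimes> (x \<otimes> y) = y"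
  using assms by (simp_all flip: m_assoc)

lemma (in group) commutator_eq_one_iff:
  assumes "x \<in> carrier G" "y \<in> carrier G"
  shows "x \<otimes> y \<otimes> inv x \<otimes> inv y = \<one> \<longleftrightarrow> x \<otimes> y = y \<otimes> x"
proof -
  have "x \<otimes> y \<otimes> inv x \<otimes> inv y = x \<otimes> y \<otimes> inv (y \<otimes> x)"
    using assms by (simp add: inv_mult_group m_assoc)
  then show ?thesis using assms inv_solve_right'[of \<one> "x \<otimes> y" "y \<otimes> x"] by simp
qed

lemma (in group) p_central_elements_normal:
  "{x \<in> carrier G. x [^] (p::nat) = \<one> \<and> (\<forall>y\<in>carrier G. x \<otimes> y = y \<otimes> x)} \<lhd> G" (is "?Z \<lhd> G")
proof -
  have comm: "a \<otimes> y = y \<otimes> a" if "a \<in> ?Z" "y \<in> carrier G" for a y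
    using that by blast
  have pow: "a \<in> carrier G" "a [^] p = \<one>" if "a \<in> ?Z" for a
    using that by blast+
  have "subgroup ?Z G"
  proof (unfold_locales, goal_cases)
    case 1
    show ?case by blast
  next
    case 3
    show ?case by simp
  next
    case (2 a b)
    note ab = pow[OF 2(1)] pow[OF 2(2)]
    have ab_pow: "(a \<otimes> b) [^] p = \<one>"
      using ab comm[OF 2(1) ab(3)] by (simp add: pow_mult_distrib)
    have ab_comm: "a \<otimes> b \<otimes> y = y \<otimes> (a \<otimes> b)" if y: "y \<in> carrier G" for y
    proof -
      have "a \<otimes> b \<otimes> y = a \<otimes> (y \<otimes> b)" using ab y comm[OF 2(2) y] by (simp add: m_assoc)
      also have "\<dots> = a \<otimes> y \<otimes> b" using ab y by (simp add: m_assoc)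
      also have "\<dots> = y \<otimes> a \<otimes> b" using comm[OF 2(1) y] by simp
      finally show ?thesis using ab y by (simp add: m_assoc)
    qed
    show ?case by (intro CollectI conjI ballI m_closed ab ab_pow ab_comm)
  next
    case (4 a)
    note a = pow[OF 4]
    have inv_comm: "inv a \<otimes> y = y \<otimes> inv a" if y: "y \<in> carrier G" for y
    proof -
      have "inv a \<otimes> y = inv a \<otimes> (y \<otimes> a) \<otimes> inv a" using a y by (simp add: m_assoc)
      also have "\<dots> = y \<otimes> inv a"
        unfolding comm[OF 4 y, symmetric] using a y by (simp add: mult_inv_cancel_left)
      finally show ?thesis .
    qed
    have inv_pow: "inv a [^] p = \<one>" using a by (simp add: nat_pow_inv)
    show ?case by (intro CollectI conjI ballI inv_closed a inv_pow inv_comm)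
  qed
  moreover have "x \<otimes> h \<otimes> inv x \<in> ?Z" if "x \<in> carrier G" "h \<in> ?Z" for x h
  proof -
    have "x \<otimes> h \<otimes> inv x = h \<otimes> x \<otimes> inv x" by (simp only: comm[OF that(2,1)])
    also have "\<dots> = h" using pow(1)[OF that(2)] that(1) by (simp add: m_assoc)
    finally show ?thesis using that(2) by (rule ssubst)
  qed
  ultimately show ?thesis unfolding normal_inv_iff by (intro conjI ballI)
qed

context normal
begin

lemma group_hom_Mod: "group_hom G (G Mod H) (\<lambda>a. H #> a)"
  by (simp add: group_hom_def group_hom_axioms_def is_group factorgroup_is_group r_coset_hom_Mod)

lemma r_coset_eq_self_iff: "x \<in> carrier G \<Longrightarrow> H #> x = H \<longleftrightarrow> x \<in> H"
  by (metis coset_join1 coset_join2 is_subgroup subset)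

text \<open>A coset \<open>H #> x\<close> is trivial exactly for \<open>x \<in> H\<close>, so
  \<open>x [^] p \<in> H\<close> and the commutator conditions become equations in
  \<open>G Mod H\<close>. Facts about central elements of the quotient can thus be pulled
  back.\<close>

lemma p_central_mod_eq_vimage:
  "p_central_mod p G H = {x \<in> carrier G. H #> x \<in>
     {c \<in> carrier (G Mod H). c [^]\<^bsub>G Mod H\<^esub> p = \<one>\<^bsub>G Mod H\<^esub> \<and>
       (\<forall>d\<in>carrier (G Mod H). c \<otimes>\<^bsub>G Mod H\<^esub> d = d \<otimes>\<^bsub>G Mod H\<^esub> c)}}"
proof -
  interpret q: group_hom G "G Mod H" "\<lambda>a. H #> a" by (rule group_hom_Mod)
  have pow: "(H #> x) [^]\<^bsub>G Mod H\<^esub> p = \<one>\<^bsub>G Mod H\<^esub> \<longleftrightarrow> x [^] p \<in> H" if "x \<in> carrier G" for x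
    using that by (simp add: FactGroup_pow r_coset_eq_self_iff)
  have comm: "(H #> x) \<otimes>\<^bsub>G Mod H\<^esub> (H #> y) = (H #> y) \<otimes>\<^bsub>G Mod H\<^esub> (H #> x) \<longleftrightarrow>
      x \<otimes> y \<otimes> inv x \<otimes> inv y \<in> H" if "x \<in> carrier G" "y \<in> carrier G" for x y
  proof -
    have "H #> (x \<otimes> y \<otimes> inv x \<otimes> inv y) =
        (H #> x) \<otimes>\<^bsub>G Mod H\<^esub> (H #> y) \<otimes>\<^bsub>G Mod H\<^esub> inv\<^bsub>G Mod H\<^esub> (H #> x) \<otimes>\<^bsub>G Mod H\<^esub> inv\<^bsub>G Mod H\<^esub> (H #> y)"
      using that by (simp only: q.hom_mult q.hom_inv m_closed inv_closed)
    then show ?thesis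
      using that q.H.commutator_eq_one_iff[of "H #> x" "H #> y"]
        r_coset_eq_self_iff[of "x \<otimes> y \<otimes> inv x \<otimes> inv y"] by simp
  qed
  have "(\<forall>d\<in>carrier (G Mod H). (H #> x) \<otimes>\<^bsub>G Mod H\<^esub> d = d \<otimes>\<^bsub>G Mod H\<^esub> (H #> x)) \<longleftrightarrow>
      (\<forall>y\<in>carrier G. x \<otimes> y \<otimes> inv x \<otimes> inv y \<in> H)" if "x \<in> carrier G" for x
    unfolding carrier_FactGroup ball_simps by (intro ball_cong refl comm that)
  then show ?thesis
    unfolding p_central_mod_def by (intro Collect_cong) (simp only: mem_Collect_eq q.hom_closed pow simp_thms cong: conj_cong)
qed

text \<open>A preimage of a normal subgroup under the quotient map.\<close>

lemma p_central_mod_normal: "p_central_mod p G H \<lhd> G"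
proof -
  interpret q: group_hom G "G Mod H" "\<lambda>a. H #> a" by (rule group_hom_Mod)
  let ?Z = "{c \<in> carrier (G Mod H). c [^]\<^bsub>G Mod H\<^esub> p = \<one>\<^bsub>G Mod H\<^esub> \<and>
       (\<forall>d\<in>carrier (G Mod H). c \<otimes>\<^bsub>G Mod H\<^esub> d = d \<otimes>\<^bsub>G Mod H\<^esub> c)}"
  interpret Z: normal ?Z "G Mod H" by (rule q.H.p_central_elements_normal)
  have conj: "H #> (x \<otimes> h \<otimes> inv x) \<in> ?Z" if "x \<in> carrier G" "h \<in> carrier G" "H #> h \<in> ?Z" for x h
  proof -
    have "H #> (x \<otimes> h \<otimes> inv x) = (H #> x) \<otimes>\<^bsub>G Mod H\<^esub> (H #> h) \<otimes>\<^bsub>G Mod H\<^esub> inv\<^bsub>G Mod H\<^esub> (H #> x)"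
      using that by (simp only: q.hom_mult q.hom_inv m_closed inv_closed)
    then show ?thesis using Z.inv_op_closed2[OF q.hom_closed[OF that(1)] that(3)] by (rule ssubst)
  qed
  show ?thesis
    unfolding p_central_mod_eq_vimage normal_inv_iff
  proof (intro conjI ballI)
    show "subgroup {x \<in> carrier G. H #> x \<in> ?Z} G"
      by (rule q.subgroup_vimage[OF Z.subgroup_axioms])
  next
    fix x h assume x: "x \<in> carrier G" and h: "h \<in> {x \<in> carrier G. H #> x \<in> ?Z}"
    from h have hG: "h \<in> carrier G" and hZ: "H #> h \<in> ?Z"
      by (simp_all only: mem_Collect_eq[of _ "\<lambda>x. x \<in> carrier G \<and> H #> x \<in> ?Z"])
    show "x \<otimes> h \<otimes> inv x \<in> {x \<in> carrier G. H #> x \<in> ?Z}"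
      by (intro CollectI[of "\<lambda>x. x \<in> carrier G \<and> H #> x \<in> ?Z"] conjI m_closed inv_closed x hG conj hZ)
  qed
qed

lemma subset_p_central_mod: "H \<subseteq> p_central_mod p G H"
proof
  fix x assume x: "x \<in> H"
  have "x [^] p \<in> H" using x by (induction p) simp_all
  moreover have "x \<otimes> y \<otimes> inv x \<otimes> inv y \<in> H" if "y \<in> carrier G" for y
  proof -
    have "y \<otimes> inv x \<otimes> inv y \<in> H" using x that by (simp add: inv_op_closed2)
    then have "x \<otimes> (y \<otimes> inv x \<otimes> inv y) \<in> H" using x by simp
    then show ?thesis using x that by (simp add: m_assoc)
  qed
  ultimately show "x \<in> p_central_mod p G H" using x by (simp add: p_central_mod_def)
qed

end

section \<open>Central elements of finite \<open>p\<close>-groups\<close>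

lemma (in group) exists_nontrivial_central_element:
  assumes p: "Factorial_Ring.prime (p::nat)" and ord: "order G = p ^ k" and nontriv: "carrier G \<noteq> {\<one>}"
  shows "\<exists>z\<in>carrier G. z \<noteq> \<one> \<and> (\<forall>y\<in>carrier G. z \<otimes> y = y \<otimes> z)"
proof (rule ccontr)
  assume no: "\<not> ?thesis"
  let ?c = "\<lambda>g. \<lambda>h\<in>carrier G. g \<otimes> h \<otimes> inv g"
  interpret C: group_action G "carrier G" ?c by (rule action_by_conjugation)
  have fin: "finite (carrier G)"
    using ord p order_gt_0_iff_finite prime_gt_0_nat by fastforce
  let ?O = "orbits G (carrier G) ?c"
  have finO: "finite ?O" using fin by (simp add: orbits_def)
  have one: "orbit G ?c \<one> = {\<one>}"
  proof -
    have "orbit G ?c \<one> = (\<lambda>g. \<one>) ` carrier G"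
      unfolding orbit_def Setcompr_eq_image by (rule image_cong) simp_all
    then show ?thesis using one_closed by blast
  qed
  then have oneO: "{\<one>} \<in> ?O" unfolding orbits_def by blast
  \<comment> \<open>\<open>B\<close> contains a noncentral \<open>x\<close> and a conjugate of
    \<open>x\<close> different from it, so \<open>card B\<close> is not 1; by orbit-stabilizer it
    divides \<open>p ^ k\<close>.\<close>
  have dvd: "p dvd card B" if B: "B \<in> ?O - {{\<one>}}" for B
  proof -
    obtain x where x: "x \<in> carrier G" and Bx: "B = orbit G ?c x"
      using B unfolding orbits_def by blast
    have "x \<noteq> \<one>" using Bx one B by blast
    then obtain y where y: "y \<in> carrier G" and xy: "x \<otimes> y \<noteq> y \<otimes> x" using no x by blast
    have 1: "x \<in> B" unfolding Bx by (rule C.orbit_refl[OF x])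
    have "?c y x \<in> B" unfolding Bx orbit_def using y by blast
    then have 2: "y \<otimes> x \<otimes> inv y \<in> B" using x by simp
    have 3: "y \<otimes> x \<otimes> inv y \<noteq> x"
    proof
      assume "y \<otimes> x \<otimes> inv y = x"
      then have "y \<otimes> x \<otimes> inv y \<otimes> y = x \<otimes> y" by simp
      then show False using x y xy by (simp add: m_assoc)
    qed
    have "card B \<noteq> 1"
    proof
      assume "card B = 1"
      then obtain b where "B = {b}" by (rule card_1_singletonE)
      then show False using 1 2 3 by simp
    qed
    moreover have "card B dvd p ^ k"
      using C.orbit_stabilizer_theorem[OF x] unfolding Bx[symmetric] ord by (rule dvdI[OF sym])
    then obtain i where "card B = p ^ i" using divides_primepow_nat[OF p] by blast
    ultimately show ?thesis by (cases i) simp_all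
  qed
  \<comment> \<open>Class equation: under the assumption \<open>no\<close>, every orbit other than
    \<open>{\<one>}\<close> has size divisible by \<open>p\<close>, whereas \<open>p\<close> also
    divides the order of the group.\<close>
  have "card (carrier G) = (\<Sum>B\<in>?O. card B)"
    using C.disjoint_sum[OF fin, of "\<lambda>_. 1::nat"] by simp
  also have "\<dots> = 1 + (\<Sum>B\<in>?O - {{\<one>}}. card B)"
    using sum.remove[OF finO oneO, of card] by simp
  finally have eq: "card (carrier G) = 1 + (\<Sum>B\<in>?O - {{\<one>}}. card B)" .
  have "card (carrier G) \<noteq> 1"
  proof
    assume "card (carrier G) = 1"
    then obtain b where b: "carrier G = {b}" by (rule card_1_singletonE)
    then show False using nontriv one_closed by simp
  qed
  then have "p dvd card (carrier G)"
    using ord unfolding order_def by (cases k) simp_all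
  moreover have "p dvd (\<Sum>B\<in>?O - {{\<one>}}. card B)" by (rule dvd_sum) (rule dvd)
  ultimately have "p dvd 1" unfolding eq by (simp only: dvd_add_left_iff)
  then show False using p by simp
qed

lemma (in group) exists_central_element_of_order_p:
  assumes p: "Factorial_Ring.prime (p::nat)" and ord: "order G = p ^ k" and nontriv: "carrier G \<noteq> {\<one>}"
  shows "\<exists>z\<in>carrier G. z \<noteq> \<one> \<and> z [^] p = \<one> \<and> (\<forall>y\<in>carrier G. z \<otimes> y = y \<otimes> z)"
proof -
  obtain z where z: "z \<in> carrier G" "z \<noteq> \<one>" "\<And>y. y \<in> carrier G \<Longrightarrow> z \<otimes> y = y \<otimes> z"
    using exists_nontrivial_central_element[OF assms] by blast
  have "z [^] (p ^ k) = \<one>" using pow_order_eq_1[OF z(1)] ord by simp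
  then have ex: "\<exists>j. z [^] (p ^ j) = \<one>" by blast
  \<comment> \<open>With \<open>j\<close> least, raising \<open>z\<close> to the power
    \<open>p ^ (j - 1)\<close> gives the wanted element: nontrivial by minimality, of order
    \<open>p\<close>, and central as a power of \<open>z\<close>.\<close>
  define j where "j = (LEAST j. z [^] (p ^ j) = \<one>)"
  have j: "z [^] (p ^ j) = \<one>" unfolding j_def using ex by (rule LeastI_ex)
  have "j \<noteq> 0" using j z(1,2) by (intro notI) simp
  then obtain i where i: "j = Suc i" by (cases j) auto
  have "z [^] (p ^ i) \<noteq> \<one>" using not_less_Least[of i "\<lambda>j. z [^] (p ^ j) = \<one>"] i unfolding j_def by auto
  moreover have "(z [^] (p ^ i)) [^] p = \<one>" using j i z(1) by (simp add: nat_pow_pow mult.commute)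
  moreover have "z [^] (p ^ i) \<otimes> y = y \<otimes> z [^] (p ^ i)" if y: "y \<in> carrier G" for y
    using y z by (simp add: group_commutes_pow)
  ultimately show ?thesis using z(1) by blast
qed

text \<open>\<open>G Mod H\<close> is a nontrivial finite \<open>p\<close>-group, and a central
  element of order \<open>p\<close> in it lifts to a new element. This strict growth drives the
  induction on the index in \<open>p_series_eventually_subset\<close>.\<close>

lemma (in normal) psubset_p_central_mod:
  assumes "Factorial_Ring.prime p" "card (rcosets H) = p ^ k" "H \<noteq> carrier G"
  shows "H \<subset> p_central_mod p G H"
proof -
  interpret q: group_hom G "G Mod H" "\<lambda>a. H #> a" by (rule group_hom_Mod)
  have "order (G Mod H) = p ^ k" using assms(2) by (simp add: order_def FactGroup_def)
  moreover obtain x where "x \<in> carrier G" "x \<notin> H" using assms(3) subset by blast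
  then have "carrier (G Mod H) \<noteq> {\<one>\<^bsub>G Mod H\<^esub>}"
    using r_coset_eq_self_iff q.hom_closed by fastforce
  ultimately obtain z where z: "z \<in> carrier (G Mod H)" "z \<noteq> \<one>\<^bsub>G Mod H\<^esub>" "z [^]\<^bsub>G Mod H\<^esub> p = \<one>\<^bsub>G Mod H\<^esub>"
      "\<forall>y\<in>carrier (G Mod H). z \<otimes>\<^bsub>G Mod H\<^esub> y = y \<otimes>\<^bsub>G Mod H\<^esub> z"
    using q.H.exists_central_element_of_order_p[OF assms(1)] by blast
  obtain x where x: "x \<in> carrier G" "z = H #> x" using z(1) by (auto simp: carrier_FactGroup)
  then have "x \<in> p_central_mod p G H" using z unfolding p_central_mod_eq_vimage by simp
  moreover have "x \<notin> H" using x z(2) r_coset_eq_self_iff by auto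
  ultimately show ?thesis using subset_p_central_mod by blast
qed

text \<open>Multiplication by \<open>M\<close> maps the cosets of \<open>N\<close> onto those of
  \<open>M\<close>, and it identifies \<open>N\<close> with \<open>N #> m\<close> for any
  \<open>m\<close> in \<open>M\<close> outside \<open>N\<close>.\<close>

lemma (in group) card_rcosets_less:
  assumes "subgroup N G" "subgroup M G" "N \<subset> M" "finite (rcosets N)"
  shows "card (rcosets M) < card (rcosets N)"
proof -
  have eq: "M <#> (N #> a) = M #> a" if "a \<in> carrier G" for a
    using set_mult_r_coset_larger assms that by blast
  have im: "(\<lambda>C. M <#> C) ` (rcosets N) = rcosets M"
    unfolding RCOSETS_def using eq by (auto simp: image_iff)
  obtain m where m: "m \<in> M" "m \<notin> N" using assms(3) by blast
  then have mG: "m \<in> carrier G" using assms(2) subgroup.mem_carrier by metis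
  have "\<not> inj_on (\<lambda>C. M <#> C) (rcosets N)"
  proof
    assume "inj_on (\<lambda>C. M <#> C) (rcosets N)"
    moreover have "M <#> (N #> m) = M <#> (N #> \<one>)"
      using eq mG m assms(2) by (simp add: coset_join2 subgroup.subset)
    ultimately have "N #> m = N #> \<one>"
      using mG by (meson inj_onD one_closed rcosetsI assms(1) subgroup.subset)
    then show False using m mG assms(1)
      by (metis coset_join1 coset_mult_one subgroup.subset)
  qed
  then show ?thesis
    using im assms(4) by (metis card_image_le eq_card_imp_inj_on le_neq_implies_less)
qed

lemma (in group) group_restrict_Mod:
  "A \<lhd> G \<Longrightarrow> B \<lhd> G \<Longrightarrow> B \<subseteq> A \<Longrightarrow> group ((G\<lparr>carrier := A\<rparr>) Mod B)"
  by (intro normal.factorgroup_is_group normal_restrict_supergroup normal_imp_subgroup)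

lemma (in group) set_mult_normal_subgroup:
  assumes "N \<lhd> G" "subgroup H G"
  shows "subgroup (N <#> H) G" "N \<subseteq> N <#> H" "H \<subseteq> N <#> H"
proof -
  interpret N: normal N G by fact
  interpret H: subgroup H G by fact
  show "subgroup (N <#> H) G" by (rule mult_norm_subgroup[OF assms])
  have "n \<in> N <#> H" if "n \<in> N" for n
    using set_mult_def[of G N H] that H.one_closed N.mem_carrier[OF that]
    by (metis (no_types, lifting) UN_I r_one singletonI)
  then show "N \<subseteq> N <#> H" by blast
  have "h \<in> N <#> H" if "h \<in> H" for h
    using set_mult_def[of G N H] that N.one_closed H.mem_carrier[OF that]
    by (metis (no_types, lifting) UN_I l_one singletonI)
  then show "H \<subseteq> N <#> H" by blast
qed

lemma (in group) mem_l_coset_self: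
  assumes "g \<in> carrier G" "\<one> \<in> U"
  shows "g \<in> g <# U"
  unfolding l_coset_def using assms by (intro UN_I[of \<one>]) simp_all

text \<open>Otherwise Bezout coefficients for the coprime pair \<open>p\<close>, \<open>i\<close>
  express \<open>y\<close> through \<open>y [^] p\<close> and \<open>y [^] i\<close>, forcing
  \<open>y \<in> M\<close>.\<close>

lemma (in group) prime_dvd_if_int_pow_mem:
  assumes "subgroup M G" "y \<in> carrier G" "y \<notin> M" "y [^] p \<in> M" "y [^] (i::int) \<in> M"
    and "Factorial_Ring.prime (p::nat)"
  shows "int p dvd i"
proof (rule ccontr)
  assume "\<not> int p dvd i"
  then have "coprime (int p) i" using assms(6) by (simp add: prime_imp_coprime)
  then obtain u w where uw: "u * int p + w * i = 1"
    using bezout_int[of "int p" i] by (auto simp: coprime_iff_gcd_eq_1)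
  have "(y [^] int p) [^] u \<otimes> (y [^] i) [^] w \<in> M"
    by (rule subgroup.m_closed[OF assms(1) subgroup_int_pow_closed[OF assms(1)]
          subgroup_int_pow_closed[OF assms(1)]]) (use assms in \<open>simp_all add: int_pow_int\<close>)
  moreover have "(y [^] int p) [^] u \<otimes> (y [^] i) [^] w = y [^] (u * int p + w * i)"
    using assms(2) by (simp only: int_pow_pow int_pow_mult mult.commute)
  ultimately show False using assms(2,3) uw by (simp add: int_pow_1)
qed

section \<open>Lower \<open>p\<close>-series in topological groups\<close>

locale top_group = group G for G :: "'a monoid" (structure) +
  fixes T :: "'a topology"
  assumes topological_group: "topological_group G T"
begin

lemma topspace_eq [simp]: "topspace T = carrier G"
  using topological_group by (simp add: topological_group_def)

lemma continuous_mult: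
  assumes "continuous_map X T f" "continuous_map X T g"
  shows "continuous_map X T (\<lambda>x. f x \<otimes> g x)"
proof -
  have "continuous_map X (prod_topology T T) (\<lambda>x. (f x, g x))"
    using assms by (simp add: continuous_map_pairwise o_def)
  moreover have "continuous_map (prod_topology T T) T (\<lambda>(x, y). x \<otimes> y)"
    using topological_group by (simp add: topological_group_def)
  ultimately have "continuous_map X T ((\<lambda>(x, y). x \<otimes> y) \<circ> (\<lambda>x. (f x, g x)))"
    by (rule continuous_map_compose)
  then show ?thesis by (simp add: o_def)
qed

lemma continuous_inv: "continuous_map T T (\<lambda>x. inv x)"
  using topological_group by (simp add: topological_group_def)

lemma open_vimage:
  assumes "continuous_map T T f" "openin T U"
  shows "openin T {x \<in> carrier G. f x \<in> U}"
  using openin_continuous_map_preimage[OF assms] by simp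

lemma openin_left_translate:
  assumes "openin T U" "g \<in> carrier G"
  shows "openin T (g <# U)"
proof -
  have U: "U \<subseteq> carrier G" using openin_subset[OF assms(1)] by simp
  have "g <# U = {x \<in> carrier G. inv g \<otimes> x \<in> U}"
  proof
    show "g <# U \<subseteq> {x \<in> carrier G. inv g \<otimes> x \<in> U}"
      using U assms(2) by (auto simp: l_coset_def mult_inv_cancel_left subset_iff)
    show "{x \<in> carrier G. inv g \<otimes> x \<in> U} \<subseteq> g <# U"
      using assms(2) by (force simp: l_coset_def mult_inv_cancel_left)
  qed
  moreover have "continuous_map T T (\<lambda>x. inv g \<otimes> x)"
    using assms(2) by (intro continuous_mult) auto
  ultimately show ?thesis using open_vimage[OF _ assms(1)] by simp
qed

lemma openin_conjugate:
  assumes "openin T U" "g \<in> carrier G"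
  shows "openin T {x \<in> carrier G. inv g \<otimes> x \<otimes> g \<in> U}"
  by (intro open_vimage continuous_mult assms) (use assms in auto)

text \<open>\<open>H\<close> is the union of the open translates \<open>h <# V\<close> with
  \<open>h \<in> H\<close>.\<close>

lemma subgroup_openin:
  assumes "subgroup H G" "openin T V" "\<one> \<in> V" "V \<subseteq> H"
  shows "openin T H"
proof -
  interpret H: subgroup H G by fact
  have "H = (\<Union>h\<in>H. h <# V)"
  proof
    show "H \<subseteq> (\<Union>h\<in>H. h <# V)"
      using mem_l_coset_self[OF H.mem_carrier assms(3)] by (intro subsetI UN_I)
    show "(\<Union>h\<in>H. h <# V) \<subseteq> H"
      using assms(4) by (auto simp: l_coset_def)
  qed
  moreover have "openin T (\<Union>h\<in>H. h <# V)"
    by (intro openin_Union) (auto intro: openin_left_translate assms(2))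
  ultimately show ?thesis by simp
qed

lemma subgroup_openin_superset:
  assumes "subgroup H G" "subgroup U G" "openin T U" "U \<subseteq> H"
  shows "openin T H"
  using subgroup_openin[OF assms(1,3) _ assms(4)] subgroup.one_closed[OF assms(2)] by blast

text \<open>The complement is the union of the cosets \<open>g <# U\<close> with \<open>g\<close>
  outside \<open>U\<close>, all of them open.\<close>

lemma open_subgroup_closedin:
  assumes "subgroup U G" "openin T U"
  shows "closedin T U"
proof -
  interpret U: subgroup U G by fact
  have "carrier G - U = (\<Union>g\<in>carrier G - U. g <# U)"
  proof
    show "carrier G - U \<subseteq> (\<Union>g\<in>carrier G - U. g <# U)"
      using mem_l_coset_self[OF _ U.one_closed] by (intro subsetI UN_I) blast+
    have "g \<otimes> u \<notin> U" if g: "g \<in> carrier G" "g \<notin> U" and u: "u \<in> U" for g u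
    proof
      assume "g \<otimes> u \<in> U"
      then have "g \<otimes> u \<otimes> inv u \<in> U" using u by blast
      then show False using g u by (simp add: m_assoc)
    qed
    then show "(\<Union>g\<in>carrier G - U. g <# U) \<subseteq> carrier G - U"
      by (auto simp: l_coset_def)
  qed
  moreover have "openin T (\<Union>g\<in>carrier G - U. g <# U)"
    by (intro openin_Union) (auto intro: openin_left_translate assms(2))
  ultimately show ?thesis using U.subset by (simp add: closedin_def)
qed

section \<open>Closed generation and the step from \<open>A\<close> to
  \<open>A^p[A,G]\<close>\<close>

lemma closed_subgroup_generated_subgroup:
  assumes "A \<subseteq> carrier G"
  shows "subgroup (closed_subgroup_generated G T A) G"
  unfolding closed_subgroup_generated_def
proof (rule subgroups_Inter)
  \<comment> \<open>The whole group belongs to the family; an empty family would have the whole type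
    as its intersection.\<close>
  show "{H. subgroup H G \<and> closedin T H \<and> A \<subseteq> H} \<noteq> {}"
    using assms subgroup_self closedin_topspace[of T] by auto
qed blast

lemma closed_subgroup_generated_closedin:
  assumes "A \<subseteq> carrier G"
  shows "closedin T (closed_subgroup_generated G T A)"
  unfolding closed_subgroup_generated_def
proof (rule closedin_Inter)
  show "{H. subgroup H G \<and> closedin T H \<and> A \<subseteq> H} \<noteq> {}"
    using assms subgroup_self closedin_topspace[of T] by auto
qed blast

lemma closed_subgroup_generated_superset: "A \<subseteq> closed_subgroup_generated G T A"
  unfolding closed_subgroup_generated_def by blast

lemma closed_subgroup_generated_minimal:
  "subgroup H G \<Longrightarrow> closedin T H \<Longrightarrow> A \<subseteq> H \<Longrightarrow> closed_subgroup_generated G T A \<subseteq> H"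
  unfolding closed_subgroup_generated_def by blast

lemma p_central_step_generators_carrier:
  assumes "A \<subseteq> carrier G"
  shows "{x [^] (p::nat) | x. x \<in> A} \<union> {x \<otimes> y \<otimes> inv x \<otimes> inv y | x y. x \<in> A \<and> y \<in> carrier G} \<subseteq> carrier G"
  using assms by (auto simp: subset_iff)

lemma p_central_step_subgroup: "A \<subseteq> carrier G \<Longrightarrow> subgroup (p_central_step p G T A) G"
  unfolding p_central_step_def
  by (intro closed_subgroup_generated_subgroup p_central_step_generators_carrier)

lemma p_central_step_closedin: "A \<subseteq> carrier G \<Longrightarrow> closedin T (p_central_step p G T A)"
  unfolding p_central_step_def
  by (intro closed_subgroup_generated_closedin p_central_step_generators_carrier)

text \<open>Together with \<open>p_central_step_subset\<close> this is a universal property: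
  \<open>p_central_step p G T A\<close> is the least closed subgroup \<open>N\<close> with
  \<open>A \<subseteq> p_central_mod p G N\<close>. Later bounds on a step are obtained by verifying
  this containment.\<close>

lemma subset_p_central_mod_step:
  assumes "A \<subseteq> carrier G"
  shows "A \<subseteq> p_central_mod p G (p_central_step p G T A)"
  using assms closed_subgroup_generated_superset[of
      "{x [^] p | x. x \<in> A} \<union> {x \<otimes> y \<otimes> inv x \<otimes> inv y | x y. x \<in> A \<and> y \<in> carrier G}"]
  unfolding p_central_mod_def p_central_step_def by blast

lemma p_central_step_subset:
  assumes "subgroup N G" "closedin T N" "A \<subseteq> p_central_mod p G N"
  shows "p_central_step p G T A \<subseteq> N"
  unfolding p_central_step_def
  using assms(3) by (intro closed_subgroup_generated_minimal assms(1,2)) (auto simp: p_central_mod_def)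

lemma p_central_step_mono:
  assumes "A \<subseteq> B" "B \<subseteq> carrier G"
  shows "p_central_step p G T A \<subseteq> p_central_step p G T B"
  using assms subset_p_central_mod_step[OF assms(2)]
  by (intro p_central_step_subset p_central_step_subgroup p_central_step_closedin) blast+

lemma p_central_step_normal:
  assumes "A \<lhd> G"
  shows "p_central_step p G T A \<lhd> G"
proof -
  interpret A: normal A G by fact
  let ?K = "p_central_step p G T A"
  interpret K: subgroup ?K G by (rule p_central_step_subgroup[OF A.subset])
  have "g \<otimes> k \<otimes> inv g \<in> ?K" if g: "g \<in> carrier G" and k: "k \<in> ?K" for g k
  proof -
    \<comment> \<open>\<open>?N\<close> is the preimage of \<open>?K\<close> under conjugation by
      \<open>g\<close>. Conjugation maps \<open>A\<close> into itself, so \<open>A\<close> is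
      \<open>p\<close>-central modulo \<open>?N\<close>, and leastness of \<open>?K\<close> gives
      \<open>?K \<subseteq> ?N\<close>.\<close>
    let ?N = "{x \<in> carrier G. g \<otimes> x \<otimes> inv g \<in> ?K}"
    have hom: "group_hom G G (\<lambda>x. g \<otimes> x \<otimes> inv g)"
      using g by unfold_locales (auto simp: hom_def m_assoc mult_inv_cancel_left)
    interpret h: group_hom G G "\<lambda>x. g \<otimes> x \<otimes> inv g" by (rule hom)
    have "continuous_map T T (\<lambda>x. g \<otimes> x \<otimes> inv g)"
      using g by (intro continuous_mult) auto
    then have "closedin T ?N"
      using closedin_continuous_map_preimage p_central_step_closedin[OF A.subset] by fastforce
    moreover have "subgroup ?N G" by (rule h.subgroup_vimage) (rule K.subgroup_axioms)
    moreover have "A \<subseteq> p_central_mod p G ?N"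
    proof
      fix a assume a: "a \<in> A"
      let ?b = "g \<otimes> a \<otimes> inv g"
      have b: "?b \<in> p_central_mod p G ?K"
        using A.inv_op_closed2[OF g a] subset_p_central_mod_step[OF A.subset] by blast
      have "g \<otimes> (a [^] p) \<otimes> inv g \<in> ?K"
        using b h.hom_nat_pow[OF A.mem_carrier[OF a]] by (simp add: p_central_mod_def)
      moreover have "g \<otimes> (a \<otimes> y \<otimes> inv a \<otimes> inv y) \<otimes> inv g \<in> ?K" if y: "y \<in> carrier G" for y
      proof -
        have "g \<otimes> (a \<otimes> y \<otimes> inv a \<otimes> inv y) \<otimes> inv g =
            ?b \<otimes> (g \<otimes> y \<otimes> inv g) \<otimes> inv ?b \<otimes> inv (g \<otimes> y \<otimes> inv g)"
          using A.mem_carrier[OF a] y by (simp only: h.hom_mult h.hom_inv m_closed inv_closed)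
        then show ?thesis using b y g unfolding p_central_mod_def by simp
      qed
      ultimately show "a \<in> p_central_mod p G ?N"
        using A.mem_carrier[OF a] unfolding p_central_mod_def by simp
    qed
    ultimately have "?K \<subseteq> ?N" by (intro p_central_step_subset)
    then show ?thesis using k by blast
  qed
  then show ?thesis using K.subgroup_axioms by (simp add: normal_inv_iff)
qed

lemma p_central_step_le:
  assumes "A \<lhd> G" "closedin T A"
  shows "p_central_step p G T A \<subseteq> A"
  using assms normal.subset_p_central_mod normal_imp_subgroup
  by (intro p_central_step_subset) blast+

section \<open>Descending series obtained by iterating the step\<close>

lemma rel_p_series_1 [simp]: "rel_p_series p A G T (Suc 0) = A"
  by (simp add: rel_p_series_def)

text \<open>The guard matters: the iteration count is \<open>n - 1\<close> with truncated
  subtraction, so the terms at 0 and 1 both equal \<open>A\<close>.\<close>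

lemma rel_p_series_Suc:
  "n \<ge> 1 \<Longrightarrow> rel_p_series p A G T (Suc n) = p_central_step p G T (rel_p_series p A G T n)"
  by (cases n) (simp_all add: rel_p_series_def)

lemma p_series_1 [simp]: "p_series p G T (Suc 0) = carrier G"
  by (simp add: p_series_def)

lemma p_series_Suc: "n \<ge> 1 \<Longrightarrow> p_series p G T (Suc n) = p_central_step p G T (p_series p G T n)"
  by (simp add: p_series_def rel_p_series_Suc)

lemma rel_p_series_normal_closedin:
  assumes "A \<lhd> G" "closedin T A" "n \<ge> 1"
  shows "rel_p_series p A G T n \<lhd> G \<and> closedin T (rel_p_series p A G T n)"
  using \<open>n \<ge> 1\<close>
proof (induction n rule: nat_induct_at_least)
  case base
  then show ?case using assms by simp
next
  case (Suc n)
  then show ?case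
    by (simp add: rel_p_series_Suc p_central_step_normal p_central_step_closedin
        normal_imp_subgroup subgroup.subset)
qed

lemma rel_p_series_Suc_subset:
  assumes "A \<lhd> G" "closedin T A" "n \<ge> 1"
  shows "rel_p_series p A G T (Suc n) \<subseteq> rel_p_series p A G T n"
  unfolding rel_p_series_Suc[OF assms(3)] using rel_p_series_normal_closedin[OF assms]
  by (intro p_central_step_le) blast+

lemma rel_p_series_antimono:
  assumes "A \<lhd> G" "closedin T A" "1 \<le> m" "m \<le> n"
  shows "rel_p_series p A G T n \<subseteq> rel_p_series p A G T m"
  using \<open>m \<le> n\<close>
proof (induction n rule: dec_induct)
  case (step k)
  then show ?case using rel_p_series_Suc_subset[OF assms(1,2), of k p] assms(3) by auto
qed simp

lemma carrier_normal_closedin: "carrier G \<lhd> G" "closedin T (carrier G)"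
  using subgroup_self closedin_topspace[of T] by (auto simp: normal_inv_iff)

lemma p_series_normal: "n \<ge> 1 \<Longrightarrow> p_series p G T n \<lhd> G"
  and p_series_closedin: "n \<ge> 1 \<Longrightarrow> closedin T (p_series p G T n)"
  and p_series_Suc_subset: "n \<ge> 1 \<Longrightarrow> p_series p G T (Suc n) \<subseteq> p_series p G T n"
  unfolding p_series_def
  using rel_p_series_normal_closedin[OF carrier_normal_closedin]
    rel_p_series_Suc_subset[OF carrier_normal_closedin] by auto

lemma p_series_antimono:
  "1 \<le> m \<Longrightarrow> m \<le> n \<Longrightarrow> p_series p G T n \<subseteq> p_series p G T m"
  unfolding p_series_def by (rule rel_p_series_antimono[OF carrier_normal_closedin])

lemma p_series_2: "p_series p G T 2 = p_central_step p G T (carrier G)"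
  using p_series_Suc[of 1 p] by (simp add: numeral_2_eq_2)

lemma carrier_subset_p_central_mod:
  assumes "p_series p G T 2 \<subseteq> N"
  shows "carrier G \<subseteq> p_central_mod p G N"
proof
  fix x assume "x \<in> carrier G"
  then have "x \<in> p_central_mod p G (p_series p G T 2)"
    using subset_p_central_mod_step[of "carrier G" p] unfolding p_series_2 by blast
  from p_central_modD[OF this] show "x \<in> p_central_mod p G N"
    using assms by (auto simp: p_central_mod_def)
qed

text \<open>A conjugate of \<open>h\<close> is a commutator times \<open>h\<close>, and all
  commutators lie in \<open>N\<close>.\<close>

lemma normal_if_p_series_2_subset:
  assumes "subgroup N G" "p_series p G T 2 \<subseteq> N"
  shows "N \<lhd> G"
proof -
  interpret N: subgroup N G by fact
  have "x \<otimes> h \<otimes> inv x \<in> N" if "x \<in> carrier G" "h \<in> N" for x h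
  proof -
    have "x \<otimes> h \<otimes> inv x \<otimes> inv h \<in> N"
      using carrier_subset_p_central_mod[OF assms(2)] that
      by (intro p_central_modD(3)[where p = p]) auto
    then have "x \<otimes> h \<otimes> inv x \<otimes> inv h \<otimes> h \<in> N" using that by blast
    then show ?thesis using that by (simp add: m_assoc)
  qed
  then show ?thesis using assms(1) by (simp add: normal_inv_iff)
qed

text \<open>The shift of the index by one is the hypothesis on \<open>A\<close> for
  \<open>n = 1\<close>, and monotonicity of the step carries it upwards. This inclusion is what
  makes \<open>iota\<close> raise degrees by one.\<close>

lemma rel_p_series_subset_p_series:
  assumes "A \<lhd> G" "closedin T A" "A \<subseteq> p_series p G T 2" "n \<ge> 1"
  shows "rel_p_series p A G T n \<subseteq> p_series p G T (Suc n)"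
  using \<open>n \<ge> 1\<close>
proof (induction n rule: nat_induct_at_least)
  case base
  then show ?case using assms by (simp add: numeral_2_eq_2)
next
  case (Suc n)
  have "p_central_step p G T (rel_p_series p A G T n) \<subseteq> p_central_step p G T (p_series p G T (Suc n))"
    by (intro p_central_step_mono Suc.IH subgroup.subset normal_imp_subgroup p_series_normal) simp
  then show ?case using Suc.hyps by (simp add: rel_p_series_Suc p_series_Suc)
qed

end

section \<open>Profinite and pro-\<open>p\<close> groups\<close>

locale profinite = top_group +
  assumes profinite_group: "profinite_group G T"
begin

lemma open_subgroup_base:
  assumes "openin T V" "\<one> \<in> V"
  obtains U where "subgroup U G" "openin T U" "U \<subseteq> V"
  using assms profinite_group unfolding profinite_group_def by blast

text \<open>Compactness, applied to the cover by the left cosets of \<open>U\<close>, which are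
  open.\<close>

lemma finite_transversal:
  assumes "subgroup U G" "openin T U"
  obtains F where "finite F" "F \<subseteq> carrier G" "carrier G \<subseteq> (\<Union>g\<in>F. g <# U)"
proof -
  have "compactin T (carrier G)"
    using profinite_group by (simp add: profinite_group_def compact_space_def)
  moreover have "\<forall>V\<in>(\<lambda>g. g <# U) ` carrier G. openin T V"
    using assms(2) by (auto intro: openin_left_translate)
  moreover have "carrier G \<subseteq> \<Union>((\<lambda>g. g <# U) ` carrier G)"
    using mem_l_coset_self[OF _ subgroup.one_closed[OF assms(1)]] by (intro subsetI UN_I)
  ultimately obtain \<F> where \<F>: "finite \<F>" "\<F> \<subseteq> (\<lambda>g. g <# U) ` carrier G" "carrier G \<subseteq> \<Union>\<F>"
    unfolding compactin_def by metis
  then obtain F where "F \<subseteq> carrier G" "finite F" "\<F> = (\<lambda>g. g <# U) ` F"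
    by (meson finite_subset_image)
  then show thesis using that \<F>(3) by blast
qed

lemma open_normal_core:
  assumes "subgroup U G" "openin T U"
  obtains N where "N \<lhd> G" "openin T N" "N \<subseteq> U"
proof
  interpret U: subgroup U G by fact
  let ?N = "{x \<in> carrier G. \<forall>g\<in>carrier G. inv g \<otimes> x \<otimes> g \<in> U}"
  show "?N \<subseteq> U"
  proof
    fix x assume x: "x \<in> ?N"
    then have "inv \<one> \<otimes> x \<otimes> \<one> \<in> U" by blast
    then show "x \<in> U" using x by simp
  qed
  have "subgroup ?N G"
  proof (unfold_locales, goal_cases)
    case (2 x y)
    then have "inv g \<otimes> (x \<otimes> y) \<otimes> g \<in> U" if g: "g \<in> carrier G" for g
    proof -
      have "inv g \<otimes> (x \<otimes> y) \<otimes> g = (inv g \<otimes> x \<otimes> g) \<otimes> (inv g \<otimes> y \<otimes> g)"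
        using 2 g by (simp add: m_assoc mult_inv_cancel_left)
      then show ?thesis using 2 g by simp
    qed
    then show ?case using 2 by simp
  next
    case (4 x)
    then have "inv g \<otimes> inv x \<otimes> g \<in> U" if g: "g \<in> carrier G" for g
    proof -
      have "inv g \<otimes> inv x \<otimes> g = inv (inv g \<otimes> x \<otimes> g)"
        using 4 g by (simp add: m_assoc inv_mult_group)
      then show ?thesis using 4 g by simp
    qed
    then show ?case using 4 by simp
  qed auto
  moreover have "h \<otimes> x \<otimes> inv h \<in> ?N" if h: "h \<in> carrier G" and x: "x \<in> ?N" for h x
  proof -
    have "inv g \<otimes> (h \<otimes> x \<otimes> inv h) \<otimes> g \<in> U" if g: "g \<in> carrier G" for g
    proof -
      have "inv (inv h \<otimes> g) \<otimes> x \<otimes> (inv h \<otimes> g) \<in> U" using x h g by simp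
      then show ?thesis using x h g by (simp add: inv_mult_group m_assoc)
    qed
    then show ?thesis using h x by simp
  qed
  ultimately show "?N \<lhd> G" unfolding normal_inv_iff by blast
  obtain F where F: "finite F" "F \<subseteq> carrier G" "carrier G \<subseteq> (\<Union>g\<in>F. g <# U)"
    using finite_transversal[OF assms] by blast
  \<comment> \<open>\<open>?N\<close> is the intersection of all conjugates of \<open>U\<close>. A
    conjugate depends only on the coset of the conjugating element, since \<open>u \<in> U\<close>
    conjugates \<open>U\<close> into itself; the finitely many representatives in \<open>F\<close>
    therefore suffice, and a finite intersection of open sets is open.\<close>
  have "?N = carrier G \<inter> (\<Inter>g\<in>F. {x \<in> carrier G. inv g \<otimes> x \<otimes> g \<in> U})"
  proof
    show "carrier G \<inter> (\<Inter>g\<in>F. {x \<in> carrier G. inv g \<otimes> x \<otimes> g \<in> U}) \<subseteq> ?N"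
    proof
      fix x assume x: "x \<in> carrier G \<inter> (\<Inter>g\<in>F. {x \<in> carrier G. inv g \<otimes> x \<otimes> g \<in> U})"
      have "inv h \<otimes> x \<otimes> h \<in> U" if hG: "h \<in> carrier G" for h
      proof -
        obtain g where g: "g \<in> F" and hg: "h \<in> g <# U"
          using subsetD[OF F(3) hG] by (rule UN_E)
        obtain u where u: "u \<in> U" and h: "h = g \<otimes> u"
          using hg by (auto simp: l_coset_def)
        have gG: "g \<in> carrier G" using g F(2) by blast
        have "inv g \<otimes> x \<otimes> g \<in> U" using x g by blast
        then have "inv u \<otimes> (inv g \<otimes> x \<otimes> g) \<otimes> u \<in> U" using u by simp
        then show ?thesis using x u gG h by (simp add: m_assoc inv_mult_group)
      qed
      then show "x \<in> ?N" using x by blast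
    qed
  qed (use F(2) in blast)
  moreover have "openin T (carrier G \<inter> (\<Inter>g\<in>F. {x \<in> carrier G. inv g \<otimes> x \<otimes> g \<in> U}))"
    using openin_INT[OF F(1), of T "\<lambda>g. {x \<in> carrier G. inv g \<otimes> x \<otimes> g \<in> U}"]
      openin_conjugate[OF assms(2)] F(2) by (auto simp: Int_commute)
  ultimately show "openin T ?N" by simp
qed

text \<open>The \<open>v\<close> with \<open>inv v \<otimes> x\<close> outside \<open>C\<close> form
  an open neighbourhood of \<open>\<one>\<close>. Any open normal subgroup inside it works, because
  \<open>x = u \<otimes> c\<close> would give \<open>inv u \<otimes> x = c\<close>.\<close>

lemma closed_subgroup_separation:
  assumes "subgroup C G" "closedin T C" "x \<in> carrier G" "x \<notin> C"
  obtains U where "U \<lhd> G" "openin T U" "x \<notin> U <#> C"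
proof -
  let ?V = "{v \<in> carrier G. inv v \<otimes> x \<in> carrier G - C}"
  have "continuous_map T T (\<lambda>v. inv v \<otimes> x)"
    using assms(3) by (intro continuous_mult continuous_inv) simp
  then have "openin T ?V"
    using assms(2) by (intro open_vimage) (auto simp: closedin_def)
  moreover have "\<one> \<in> ?V" using assms(3,4) by simp
  ultimately obtain U0 where U0: "subgroup U0 G" "openin T U0" "U0 \<subseteq> ?V"
    by (rule open_subgroup_base)
  obtain U where U: "U \<lhd> G" "openin T U" "U \<subseteq> U0"
    using open_normal_core[OF U0(1,2)] by blast
  have "x \<notin> U <#> C"
  proof
    assume "x \<in> U <#> C"
    then obtain u c where uc: "u \<in> U" "c \<in> C" "x = u \<otimes> c" unfolding set_mult_def by blast
    then have "inv u \<otimes> x \<notin> C" and "u \<in> carrier G" "c \<in> carrier G"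
      using U(3) U0(3) subgroup.mem_carrier[OF assms(1)] by blast+
    then show False using uc by (simp add: mult_inv_cancel_left)
  qed
  then show thesis using that U by blast
qed

end

locale pro_p = profinite +
  fixes p :: nat
  assumes prime_p: "Factorial_Ring.prime p" and pro_p_group: "pro_p_group p G T"
begin

text \<open>Induction on the index of \<open>U\<close>: the larger subgroup
  \<open>p_central_mod p G U\<close> has smaller index, and once it contains a term of the series,
  the next term lies in \<open>U\<close>.\<close>

lemma p_series_eventually_subset:
  assumes "U \<lhd> G" "openin T U"
  shows "\<exists>m\<ge>1. p_series p G T m \<subseteq> U"
  using assms
proof (induction "card (rcosets U)" arbitrary: U rule: less_induct)
  case less
  interpret U: normal U G by (rule less.prems)
  obtain k where k: "card (rcosets U) = p ^ k"
    using pro_p_group less.prems unfolding pro_p_group_def by blast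
  \<comment> \<open>\<open>card\<close> is 0 on infinite sets, and \<open>p ^ k\<close> is
    positive.\<close>
  then have fin: "finite (rcosets U)" using prime_p prime_gt_0_nat by (fastforce intro: card_ge_0_finite)
  show ?case
  proof (cases "U = carrier G")
    case True
    then show ?thesis by (intro exI[of _ "Suc 0"]) simp
  next
    case False
    let ?N = "p_central_mod p G U"
    have N: "?N \<lhd> G" by (rule U.p_central_mod_normal)
    have less_N: "U \<subset> ?N" by (rule U.psubset_p_central_mod[OF prime_p k False])
    have "openin T ?N"
      using less_N by (intro subgroup_openin_superset[OF _ U.subgroup_axioms less.prems(2)])
        (auto intro: normal_imp_subgroup N)
    moreover have "card (rcosets ?N) < card (rcosets U)"
      using card_rcosets_less[OF U.subgroup_axioms normal_imp_subgroup[OF N] less_N fin] .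
    ultimately obtain m where m: "m \<ge> 1" "p_series p G T m \<subseteq> ?N"
      using less.hyps N by blast
    have "p_series p G T (Suc m) \<subseteq> U"
      unfolding p_series_Suc[OF m(1)]
      by (intro p_central_step_subset U.subgroup_axioms open_subgroup_closedin less.prems(2) m(2))
    then show ?thesis using m(1) by (intro exI[of _ "Suc m"]) simp
  qed
qed

text \<open>If \<open>K G\<^bsup>(n)\<^esup> = G\<close>, then \<open>K G\<^bsup>(n+1)\<^esup>\<close> is normal with elementary abelian quotient, so it
  contains \<open>G\<^bsup>(2)\<^esup>\<close> and hence equals \<open>G\<close>; and \<open>G\<^bsup>(n)\<^esup> \<subseteq> K\<close> for large \<open>n\<close>.\<close>

lemma open_subgroup_p_series_nongenerator:
  assumes "subgroup K G" "openin T K" "p_series p G T 2 <#> K = carrier G"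
  shows "K = carrier G"
proof -
  interpret K: subgroup K G by fact
  have gen: "p_series p G T n <#> K = carrier G" if "n \<ge> 2" for n
    using that
  proof (induction n rule: nat_induct_at_least)
    case base
    show ?case by (fact assms(3))
  next
    case (Suc n)
    let ?A = "p_series p G T n" and ?Q = "p_series p G T (Suc n)"
    let ?L = "?Q <#> K"
    have Q: "?Q \<lhd> G" and A: "?A \<lhd> G" using Suc.hyps by (simp_all add: p_series_normal)
    interpret Q: normal ?Q G by (rule Q)
    interpret A: normal ?A G by (rule A)
    note L = set_mult_normal_subgroup[OF Q assms(1)]
    interpret L: subgroup ?L G by (rule L(1))
    have AQ: "?A \<subseteq> p_central_mod p G ?Q"
      using subset_p_central_mod_step[OF A.subset] Suc.hyps by (simp add: p_series_Suc)
    have AL: "?A \<subseteq> p_central_mod p G ?L"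
      using AQ L(2) unfolding p_central_mod_def by blast
    \<comment> \<open>In \<open>x = a \<otimes> k\<close> the factor \<open>k\<close> lies in
      \<open>?L\<close>, and \<open>a\<close> commutes with \<open>?L\<close> modulo
      \<open>?L\<close>, so conjugation by either factor preserves \<open>?L\<close>.\<close>
    have "x \<otimes> y \<otimes> inv x \<in> ?L" if x: "x \<in> carrier G" and y: "y \<in> ?L" for x y
    proof -
      obtain a k where a: "a \<in> ?A" and k: "k \<in> K" and xak: "x = a \<otimes> k"
        using x Suc.IH unfolding set_mult_def by blast
      have kL: "k \<in> ?L" using k L(3) by blast
      define z where "z = k \<otimes> y \<otimes> inv k"
      have z: "z \<in> ?L" unfolding z_def using kL y by simp
      have "a \<otimes> z \<otimes> inv a \<otimes> inv z \<in> ?L"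
        by (rule p_central_modD(3)[OF subsetD[OF AL a] L.mem_carrier[OF z]])
      then have "a \<otimes> z \<otimes> inv a \<otimes> inv z \<otimes> z \<in> ?L" using z by blast
      then have "a \<otimes> z \<otimes> inv a \<in> ?L" using z a by (simp add: m_assoc)
      then show ?thesis unfolding z_def xak using a k y by (simp add: m_assoc inv_mult_group)
    qed
    then have normL: "?L \<lhd> G" using L.subgroup_axioms by (simp add: normal_inv_iff)
    interpret \<Omega>: normal "p_central_mod p G ?L" G by (rule normal.p_central_mod_normal[OF normL])
    \<comment> \<open>The right side is a subgroup containing both \<open>?A\<close> and
      \<open>K\<close>, whose product is everything.\<close>
    have "carrier G \<subseteq> p_central_mod p G ?L"
    proof
      fix x assume "x \<in> carrier G"
      then obtain a k where "a \<in> ?A" "k \<in> K" "x = a \<otimes> k"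
        using Suc.IH unfolding set_mult_def by blast
      then show "x \<in> p_central_mod p G ?L"
        using AL L(3) normal.subset_p_central_mod[OF normL] by blast
    qed
    then have "p_series p G T (Suc 1) \<subseteq> ?L"
      unfolding p_series_Suc[OF order.refl]
      by (intro p_central_step_subset L.subgroup_axioms open_subgroup_closedin
          subgroup_openin_superset[OF L(1) assms(1,2) L(3)]) simp
    then have "p_series p G T 2 <#> K \<subseteq> ?L"
      using mono_set_mult[OF _ L(3), of "p_series p G T 2" ?L G] subgroup_mult_id[OF L(1)]
      by (simp add: numeral_2_eq_2)
    then show ?case using assms(3) L.subset by blast
  qed
  obtain N where N: "N \<lhd> G" "openin T N" "N \<subseteq> K"
    using open_normal_core[OF assms(1,2)] by blast
  obtain m where m: "m \<ge> 1" "p_series p G T m \<subseteq> N"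
    using p_series_eventually_subset[OF N(1,2)] by blast
  \<comment> \<open>\<open>gen\<close> requires an index of at least 2, while \<open>m\<close> may
    be 1; hence \<open>Suc m\<close>.\<close>
  have "p_series p G T (Suc m) \<subseteq> K" using m N(3) p_series_Suc_subset[of m p] by blast
  then have "p_series p G T (Suc m) <#> K \<subseteq> K" unfolding set_mult_def by auto
  then show ?thesis using gen[of "Suc m"] m(1) K.subset by auto
qed

text \<open>Separating a missing point from \<open>H\<close> enlarges \<open>H\<close> to a proper
  open subgroup \<open>U <#> H\<close>; multiplying by \<open>p_series p G T 2\<close> keeps it
  proper by the nongenerator property.\<close>

lemma proper_closed_subgroup_in_open_Frattini:
  assumes "subgroup H G" "closedin T H" "H \<noteq> carrier G"
  obtains N where "subgroup N G" "openin T N" "H \<subseteq> N" "p_series p G T 2 \<subseteq> N" "N \<noteq> carrier G"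
proof -
  obtain x where x: "x \<in> carrier G" "x \<notin> H" using assms(3) subgroup.subset[OF assms(1)] by blast
  obtain U where U: "U \<lhd> G" "openin T U" "x \<notin> U <#> H"
    using closed_subgroup_separation[OF assms(1,2) x] by blast
  note K = set_mult_normal_subgroup[OF U(1) assms(1)]
  have openK: "openin T (U <#> H)"
    by (rule subgroup_openin_superset[OF K(1) normal_imp_subgroup[OF U(1)] U(2) K(2)])
  let ?N = "p_series p G T 2 <#> (U <#> H)"
  note N = set_mult_normal_subgroup[OF p_series_normal[of 2 p] K(1)]
  show thesis
  proof (rule that)
    show "?N \<noteq> carrier G"
      using open_subgroup_p_series_nongenerator[OF K(1) openK] x(1) U(3) by blast
    show "openin T ?N" using N by (intro subgroup_openin_superset[OF _ K(1) openK]) simp_all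
  qed (use N K(3) in auto)
qed

end

section \<open>Minimal presentations\<close>

text \<open>The subgroups \<open>M y\<close> act as coordinate hyperplanes dual to \<open>X\<close> in \<open>G / G\<^bsup>(2)\<^esup>\<close>.\<close>

lemma (in pro_p) Int_separating_subgroups_subset:
  assumes "finite Y" "Y \<subseteq> X" and gen: "closed_subgroup_generated G T X = carrier G"
    and M: "\<And>y. y \<in> Y \<Longrightarrow> subgroup (M y) G \<and> openin T (M y) \<and> p_series p G T 2 \<subseteq> M y \<and> X - {y} \<subseteq> M y \<and> y \<notin> M y"
    and W: "subgroup W G" "openin T W" "p_series p G T 2 \<subseteq> W" "X - W \<subseteq> Y"
    and X: "X \<subseteq> carrier G"
  shows "carrier G \<inter> (\<Inter>y\<in>Y. M y) \<subseteq> W"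
  using \<open>finite Y\<close> \<open>Y \<subseteq> X\<close> M W
proof (induction Y arbitrary: W)
  case empty
  \<comment> \<open>With no index left, \<open>X \<subseteq> W\<close>; an open subgroup is closed,
    so \<open>W\<close> is everything.\<close>
  then have "closed_subgroup_generated G T X \<subseteq> W"
    by (intro closed_subgroup_generated_minimal open_subgroup_closedin) auto
  then show ?case using gen by blast
next
  case (insert y Y)
  have My: "subgroup (M y) G" "openin T (M y)" "p_series p G T 2 \<subseteq> M y" "X - {y} \<subseteq> M y" "y \<notin> M y"
    using insert.prems(2)[of y] by auto
  have yX: "y \<in> X" and y: "y \<in> carrier G" using insert.prems(1) X by auto
  let ?V = "W \<inter> M y"
  have V: "subgroup ?V G" "openin T ?V" "p_series p G T 2 \<subseteq> ?V"
    using subgroups_Inter_pair insert.prems(3-5) My by (auto intro: openin_Int)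
  have Vn: "?V \<lhd> G" by (rule normal_if_p_series_2_subset[OF V(1,3)])
  have C: "subgroup (generate G {y}) G" using y by (intro generate_is_subgroup) simp
  \<comment> \<open>Adjoining \<open>y\<close> to \<open>W \<inter> M y\<close> leaves only
    generators from \<open>Y\<close> outside: the generators other than \<open>y\<close> lie in
    \<open>M y\<close>, so one outside \<open>?V'\<close> is already outside
    \<open>W\<close>.\<close>
  let ?V' = "?V <#> generate G {y}"
  note V' = set_mult_normal_subgroup[OF Vn C]
  have "y \<in> ?V'" using V'(3) generate.incl[of y "{y}" G] by blast
  have "carrier G \<inter> (\<Inter>y\<in>Y. M y) \<subseteq> ?V'"
  proof (rule insert.IH)
    show "openin T ?V'" by (rule subgroup_openin_superset[OF V'(1) V(1,2) V'(2)])
    show "p_series p G T 2 \<subseteq> ?V'" using V(3) V'(2) by (rule subset_trans)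
    show "X - ?V' \<subseteq> Y"
    proof
      fix x assume x: "x \<in> X - ?V'"
      then have "x \<noteq> y" using \<open>y \<in> ?V'\<close> by blast
      then have "x \<in> M y" using x My(4) by blast
      moreover have "x \<notin> ?V" using x V'(2) by blast
      ultimately show "x \<in> Y" using x insert.prems(6) \<open>x \<noteq> y\<close> by blast
    qed
  qed (use insert.prems(1,2) V'(1) in auto)
  \<comment> \<open>For \<open>s = v \<otimes> y [^] i\<close> in \<open>M y\<close> the factor
    \<open>y [^] i\<close> is in \<open>M y\<close> too. As \<open>y\<close> is not, but
    \<open>y [^] p\<close> is, \<open>p\<close> divides \<open>i\<close>, and then
    \<open>y [^] i\<close> is a power of \<open>y [^] p \<in> W\<close>.\<close>
  moreover have "s \<in> W" if s: "s \<in> ?V'" "s \<in> M y" for s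
  proof -
    obtain v i where v: "v \<in> ?V" and si: "s = v \<otimes> y [^] (i::int)"
      using s(1) unfolding set_mult_def generate_pow[OF y] by blast
    have vG: "v \<in> carrier G" using subgroup.mem_carrier[OF V(1) v] .
    have "inv v \<otimes> s \<in> M y" using v s(2) My(1) by (simp add: subgroup.m_closed subgroup.m_inv_closed)
    then have "y [^] i \<in> M y" using vG y si by (simp add: mult_inv_cancel_left)
    moreover have yp: "y [^] p \<in> p_series p G T 2"
      using carrier_subset_p_central_mod[OF order.refl] y by (blast intro: p_central_modD(2))
    ultimately have "int p dvd i"
      using prime_dvd_if_int_pow_mem[OF My(1) y My(5) _ _ prime_p] My(3) by blast
    then obtain j where "i = int p * j" by (rule dvdE)
    then have "y [^] i = (y [^] p) [^] j" using y by (simp add: int_pow_pow int_pow_int[symmetric])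
    moreover have "y [^] p \<in> W" using yp insert.prems(5) by blast
    ultimately have "y [^] i \<in> W" using subgroup_int_pow_closed[OF insert.prems(3)] by simp
    then show ?thesis using si v insert.prems(3) by (simp add: subgroup.m_closed)
  qed
  ultimately show ?case by auto
qed

lemma kernel_subset_p_series_2:
  assumes "pro_p S TS p" "pro_p G TG p"
    and hom: "\<pi> \<in> hom S G" and cont: "continuous_map TS TG \<pi>"
    and genS: "generating_set S TS X" and inj: "inj_on \<pi> X"
    and minG: "minimal_generating_set G TG (\<pi> ` X)"
  shows "kernel S G \<pi> \<subseteq> p_series p S TS 2"
proof
  interpret S: pro_p S TS p by fact
  interpret G: pro_p G TG p by fact
  interpret h: group_hom S G \<pi> using hom by unfold_locales
  have X: "X \<subseteq> carrier S" "closed_subgroup_generated S TS X = carrier S" "converges_to_one S TS X (\<lambda>x. x)"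
    using genS by (auto simp: generating_set_def)
  have gen: "\<pi> ` X \<subseteq> carrier G" "converges_to_one G TG (\<pi> ` X) (\<lambda>x. x)"
    "closed_subgroup_generated G TG (\<pi> ` X) = carrier G"
    using minG by (auto simp: minimal_generating_set_def generating_set_def)
  let ?P = "\<lambda>y M. subgroup M S \<and> openin TS M \<and> p_series p S TS 2 \<subseteq> M \<and> X - {y} \<subseteq> M \<and> y \<notin> M \<and> kernel S G \<pi> \<subseteq> M"
  have "\<exists>M. ?P y M" if y: "y \<in> X" for y
  proof -
    \<comment> \<open>By minimality \<open>?Y\<close> generates a proper closed subgroup. It lies in
      a proper open \<open>N\<close> above the second term of the series of \<open>G\<close>, and
      the preimage of \<open>N\<close> is the required subgroup.\<close>
    let ?Y = "\<pi> ` X - {\<pi> y}"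
    have "\<not> generating_set G TG ?Y"
      using minG y unfolding minimal_generating_set_def by blast
    \<comment> \<open>Dropping an element preserves convergence to 1, so what fails for
      \<open>?Y\<close> must be generation.\<close>
    moreover have "converges_to_one G TG ?Y (\<lambda>x. x)"
      unfolding converges_to_one_def
    proof (intro allI impI)
      fix U assume U: "subgroup U G \<and> openin TG U"
      have "finite {x \<in> \<pi> ` X. x \<notin> U}" using gen(2) U unfolding converges_to_one_def by blast
      then show "finite {x \<in> ?Y. x \<notin> U}" by (rule rev_finite_subset) blast
    qed
    moreover have YG: "?Y \<subseteq> carrier G" using gen(1) by blast
    ultimately have "closed_subgroup_generated G TG ?Y \<noteq> carrier G"
      unfolding generating_set_def by blast
    then obtain N where N: "subgroup N G" "openin TG N" "closed_subgroup_generated G TG ?Y \<subseteq> N"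
        "p_series p G TG 2 \<subseteq> N" "N \<noteq> carrier G"
      using G.proper_closed_subgroup_in_open_Frattini[OF G.closed_subgroup_generated_subgroup[OF YG]
          G.closed_subgroup_generated_closedin[OF YG]] by blast
    have YN: "?Y \<subseteq> N" using N(3) G.closed_subgroup_generated_superset by (rule subset_trans[rotated])
    have yN: "\<pi> y \<notin> N"
    proof
      assume "\<pi> y \<in> N"
      then have "\<pi> ` X \<subseteq> N" using YN unfolding Diff_subset_conv by (simp add: insert_absorb)
      then have "carrier G \<subseteq> N"
        unfolding gen(3)[symmetric]
        by (rule G.closed_subgroup_generated_minimal[OF N(1) G.open_subgroup_closedin[OF N(1,2)]])
      then show False using N(5) subgroup.subset[OF N(1)] by blast
    qed
    let ?M = "{s \<in> carrier S. \<pi> s \<in> N}"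
    have M: "subgroup ?M S" by (rule h.subgroup_vimage[OF N(1)])
    have Mo: "openin TS ?M" using openin_continuous_map_preimage[OF cont N(2)] by simp
    have "carrier S \<subseteq> p_central_mod p S ?M"
    proof
      fix x assume x: "x \<in> carrier S"
      then have px: "\<pi> x \<in> p_central_mod p G N"
        using G.carrier_subset_p_central_mod[OF N(4)] by auto
      note x' = p_central_modD[OF px]
      show "x \<in> p_central_mod p S ?M"
        unfolding p_central_mod_def using x x' by (simp add: h.hom_nat_pow)
    qed
    then have "p_series p S TS 2 \<subseteq> ?M"
      unfolding S.p_series_2 by (intro S.p_central_step_subset M S.open_subgroup_closedin Mo)
    moreover have "X - {y} \<subseteq> ?M"
    proof
      fix x assume x: "x \<in> X - {y}"
      \<comment> \<open>Injectivity on \<open>X\<close> keeps the images of the other generators in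
        \<open>?Y\<close>, hence in \<open>N\<close>.\<close>
      then have "\<pi> x \<noteq> \<pi> y" using inj y by (auto dest: inj_onD)
      then show "x \<in> ?M" using x YN X(1) by blast
    qed
    moreover have "kernel S G \<pi> \<subseteq> ?M"
      using subgroup.one_closed[OF N(1)] by (auto simp: kernel_def)
    ultimately show ?thesis using M Mo yN by blast
  qed
  then obtain M where M: "\<And>y. y \<in> X \<Longrightarrow> ?P y (M y)" by metis
  fix r assume r: "r \<in> kernel S G \<pi>"
  then have rS: "r \<in> carrier S" by (simp add: kernel_def)
  show "r \<in> p_series p S TS 2"
  proof (rule ccontr)
    assume "r \<notin> p_series p S TS 2"
    then obtain U where U: "U \<lhd> S" "openin TS U" "r \<notin> U <#>\<^bsub>S\<^esub> p_series p S TS 2"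
      using S.closed_subgroup_separation[OF normal_imp_subgroup[OF S.p_series_normal[of 2 p]]
          S.p_series_closedin[of 2 p] rS] by auto
    \<comment> \<open>Convergence to 1 leaves only finitely many generators outside the open
      subgroup \<open>?W\<close>, so finitely many of the \<open>M y\<close> already intersect
      inside \<open>?W\<close>; \<open>r\<close> lies in all of them.\<close>
    let ?W = "U <#>\<^bsub>S\<^esub> p_series p S TS 2"
    note W = S.set_mult_normal_subgroup[OF U(1) normal_imp_subgroup[OF S.p_series_normal[of 2 p]]]
    have Wo: "openin TS ?W"
      using W by (intro S.subgroup_openin_superset[OF _ normal_imp_subgroup[OF U(1)] U(2)]) simp_all
    let ?Y = "{x \<in> X. x \<notin> ?W}"
    have "finite ?Y" using X(3) W(1) Wo unfolding converges_to_one_def by simp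
    then have "carrier S \<inter> (\<Inter>y\<in>?Y. M y) \<subseteq> ?W"
      using M W Wo X by (intro S.Int_separating_subgroups_subset[where X = X]) auto
    moreover have "r \<in> M y" if "y \<in> X" for y using M[OF that] r by blast
    ultimately show False using rS U(3) by blast
  qed
qed

section \<open>The map \<open>\<iota>\<close>\<close>

context pro_p
begin

context
  fixes R :: "'a set"
  assumes R_normal: "R \<lhd> G" and R_closed: "closedin T R" and R_subset: "R \<subseteq> p_series p G T 2"
begin

text \<open>In this context \<open>G\<close> stands for the group \<open>S\<close> of the
  presentation. Condition (A) reads \<open>rel n = ind (Suc n)\<close>, and \<open>iota\<close> maps
  \<open>rel n\<close> modulo \<open>rel (Suc n)\<close> to \<open>ind (Suc n)\<close> modulo
  \<open>ind (Suc (Suc n))\<close>.\<close>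

abbreviation "rel n \<equiv> rel_p_series p R G T n"
abbreviation "ind n \<equiv> R \<inter> p_series p G T n"

lemma rel_normal: "n \<ge> 1 \<Longrightarrow> rel n \<lhd> G"
  and rel_closedin: "n \<ge> 1 \<Longrightarrow> closedin T (rel n)"
  and rel_Suc_subset: "n \<ge> 1 \<Longrightarrow> rel (Suc n) \<subseteq> rel n"
  using rel_p_series_normal_closedin[OF R_normal R_closed]
    rel_p_series_Suc_subset[OF R_normal R_closed] by auto

lemma rel_subset_ind:
  assumes "n \<ge> 1"
  shows "rel n \<subseteq> ind (Suc n)"
  using rel_p_series_antimono[OF R_normal R_closed order.refl assms]
    rel_p_series_subset_p_series[OF R_normal R_closed R_subset assms] by auto

lemma ind_normal: "n \<ge> 1 \<Longrightarrow> ind n \<lhd> G"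
  by (intro normal_subgroup_intersect R_normal p_series_normal)

text \<open>Since the first two terms coincide, degree 1 of \<open>gr_ind\<close> is trivial, which
  matches the degree shift of \<open>iota\<close>.\<close>

lemma ind_1: "ind (Suc 0) = R" and ind_2: "ind 2 = R"
  using R_subset subgroup.subset[OF normal_imp_subgroup[OF R_normal]] by auto

lemma group_gr_rel_n: "n \<ge> 1 \<Longrightarrow> group (gr_rel_n p R G T n)"
  unfolding gr_rel_n_def using rel_Suc_subset[of n] by (intro group_restrict_Mod rel_normal) auto

lemma group_gr_ind_n: "n \<ge> 1 \<Longrightarrow> group (gr_ind_n p R G T n)"
  unfolding gr_ind_n_def using p_series_Suc_subset[of n p] by (intro group_restrict_Mod ind_normal) auto

lemma carrier_gr_rel_n: "carrier (gr_rel_n p R G T n) = (\<lambda>a. rel (Suc n) #> a) ` rel n"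
  and one_gr_rel_n: "\<one>\<^bsub>gr_rel_n p R G T n\<^esub> = rel (Suc n)"
  by (simp_all add: gr_rel_n_def carrier_FactGroup)

lemma carrier_gr_ind_n: "carrier (gr_ind_n p R G T n) = (\<lambda>a. ind (Suc n) #> a) ` ind n"
  and one_gr_ind_n: "\<one>\<^bsub>gr_ind_n p R G T n\<^esub> = ind (Suc n)"
  by (simp_all add: gr_ind_n_def carrier_FactGroup)

lemma mem_gr_rel_iff:
  "f \<in> carrier (gr_rel p R G T) \<longleftrightarrow>
    f \<in> (\<Pi>\<^sub>E n\<in>{1..}. carrier (gr_rel_n p R G T n)) \<and> finite {n \<in> {1..}. f n \<noteq> rel (Suc n)}"
  unfolding gr_rel_def by (subst carrier_sum_group) (simp_all add: group_gr_rel_n one_gr_rel_n)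

lemma mem_gr_ind_iff:
  "f \<in> carrier (gr_ind p R G T) \<longleftrightarrow>
    f \<in> (\<Pi>\<^sub>E n\<in>{1..}. carrier (gr_ind_n p R G T n)) \<and> finite {n \<in> {1..}. f n \<noteq> ind (Suc n)}"
  unfolding gr_ind_def by (subst carrier_sum_group) (simp_all add: group_gr_ind_n one_gr_ind_n)

lemma gr_rel_component:
  assumes "f \<in> carrier (gr_rel p R G T)" "n \<ge> 1"
  obtains a where "a \<in> rel n" "a \<in> carrier G" "f n = rel (Suc n) #> a"
proof -
  have "f n \<in> carrier (gr_rel_n p R G T n)"
    using assms PiE_mem[of f "{1..}" _ n] unfolding mem_gr_rel_iff by auto
  then obtain a where "a \<in> rel n" "f n = rel (Suc n) #> a" unfolding carrier_gr_rel_n by blast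
  then show thesis
    using that subgroup.mem_carrier[OF normal_imp_subgroup[OF rel_normal[OF assms(2)]]] by simp
qed

lemma iota_1: "iota p R G T f (Suc 0) = ind 2"
  by (simp add: iota_def one_gr_ind_n numeral_2_eq_2)

lemma iota_Suc: "n \<ge> 1 \<Longrightarrow> iota p R G T f (Suc n) = ind (Suc (Suc n)) <#> f n"
  by (simp add: iota_def iota_n_def)

text \<open>On representatives \<open>iota\<close> is the identity: only the denominator grows, from
  \<open>rel (Suc n)\<close> to \<open>ind (Suc (Suc n))\<close>.\<close>

lemma iota_coset:
  assumes "n \<ge> 1" "a \<in> carrier G" "f n = rel (Suc n) #> a"
  shows "iota p R G T f (Suc n) = ind (Suc (Suc n)) #> a"
  unfolding iota_Suc[OF assms(1)] assms(3) using assms(2)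
  by (intro set_mult_r_coset_larger normal_imp_subgroup rel_normal ind_normal rel_subset_ind) simp_all

text \<open>Homogeneous elements, zero outside degree \<open>n\<close>. With them, injectivity and
  surjectivity on the direct sums are tested in a single degree.\<close>

lemma single_mem_gr_rel:
  assumes "n \<ge> 1" "a \<in> rel n"
  shows "(\<lambda>i\<in>{1..}. if i = n then rel (Suc n) #> a else rel (Suc i)) \<in> carrier (gr_rel p R G T)" (is "?f \<in> _")
  unfolding mem_gr_rel_iff
proof
  have "rel (Suc i) \<in> carrier (gr_rel_n p R G T i)" if "i \<ge> 1" for i
    using group.is_monoid[OF group_gr_rel_n[OF that]] monoid.one_closed one_gr_rel_n by metis
  then show "?f \<in> (\<Pi>\<^sub>E n\<in>{1..}. carrier (gr_rel_n p R G T n))"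
    using assms by (auto simp: carrier_gr_rel_n)
  show "finite {i \<in> {1..}. ?f i \<noteq> rel (Suc i)}"
    by (rule finite_subset[of _ "{n}"]) auto
qed

lemma single_mem_gr_ind:
  assumes "n \<ge> 1" "a \<in> ind n"
  shows "(\<lambda>i\<in>{1..}. if i = n then ind (Suc n) #> a else ind (Suc i)) \<in> carrier (gr_ind p R G T)" (is "?f \<in> _")
  unfolding mem_gr_ind_iff
proof
  have "ind (Suc i) \<in> carrier (gr_ind_n p R G T i)" if "i \<ge> 1" for i
    using group.is_monoid[OF group_gr_ind_n[OF that]] monoid.one_closed one_gr_ind_n by metis
  moreover have "ind (Suc n) #> a \<in> carrier (gr_ind_n p R G T n)"
    unfolding carrier_gr_ind_n using assms(2) by (rule imageI)
  ultimately show "?f \<in> (\<Pi>\<^sub>E n\<in>{1..}. carrier (gr_ind_n p R G T n))" by auto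
  show "finite {i \<in> {1..}. ?f i \<noteq> ind (Suc i)}"
    by (rule finite_subset[of _ "{n}"]) auto
qed

section \<open>(A) implies (B) and (C)\<close>

lemma rel_eq_ind_imp_iota_Suc:
  assumes eq: "\<forall>n\<ge>1. rel n = ind (Suc n)" and f: "f \<in> carrier (gr_rel p R G T)" and n: "n \<ge> 1"
  shows "iota p R G T f (Suc n) = f n"
proof -
  obtain a where a: "a \<in> rel n" "a \<in> carrier G" "f n = rel (Suc n) #> a"
    using gr_rel_component[OF f n] by blast
  \<comment> \<open>The two denominators agree by \<open>eq\<close>, so \<open>iota\<close> is a
    pure shift of the index.\<close>
  show ?thesis using iota_coset[where f = f, OF n a(2,3)] a(3) spec[OF eq, of "Suc n"] by simp
qed

lemma rel_eq_ind_imp_iota_inj: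
  assumes eq: "\<forall>n\<ge>1. rel n = ind (Suc n)"
  shows "inj_on (iota p R G T) (carrier (gr_rel p R G T))"
proof (rule inj_onI)
  fix f g assume f: "f \<in> carrier (gr_rel p R G T)" and g: "g \<in> carrier (gr_rel p R G T)"
    and fg: "iota p R G T f = iota p R G T g"
  show "f = g"
  proof (rule PiE_ext)
    show "f \<in> (\<Pi>\<^sub>E n\<in>{1..}. carrier (gr_rel_n p R G T n))" "g \<in> (\<Pi>\<^sub>E n\<in>{1..}. carrier (gr_rel_n p R G T n))"
      using f g by (simp_all only: mem_gr_rel_iff)
    show "f n = g n" if "n \<in> {1..}" for n
      using rel_eq_ind_imp_iota_Suc[OF eq f, of n] rel_eq_ind_imp_iota_Suc[OF eq g, of n] fg that by simp
  qed
qed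

lemma rel_eq_ind_imp_iota_surj:
  assumes eq: "\<forall>n\<ge>1. rel n = ind (Suc n)"
  shows "iota p R G T ` carrier (gr_rel p R G T) = carrier (gr_ind p R G T)"
proof
  have car: "carrier (gr_rel_n p R G T n) = carrier (gr_ind_n p R G T (Suc n))" if "n \<ge> 1" for n
    unfolding carrier_gr_rel_n carrier_gr_ind_n using mp[OF spec[OF eq] that] spec[OF eq, of "Suc n"] by simp
  \<comment> \<open>The shift never reaches degree 1, so surjectivity needs that component to be
    trivial.\<close>
  have car1: "carrier (gr_ind_n p R G T (Suc 0)) = {ind 2}"
  proof -
    have "ind 2 #> a = ind 2" if "a \<in> R" for a
      using that subgroup.rcos_const[OF normal_imp_subgroup[OF R_normal]] is_group by (simp add: ind_2)
    moreover have "R \<noteq> {}" using subgroup.one_closed[OF normal_imp_subgroup[OF R_normal]] by blast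
    ultimately show ?thesis unfolding carrier_gr_ind_n ind_1 numeral_2_eq_2[symmetric] by auto
  qed
  show "iota p R G T ` carrier (gr_rel p R G T) \<subseteq> carrier (gr_ind p R G T)"
  proof (rule image_subsetI)
    fix f assume f: "f \<in> carrier (gr_rel p R G T)"
    note fSuc = rel_eq_ind_imp_iota_Suc[OF eq f]
    have "iota p R G T f m \<in> carrier (gr_ind_n p R G T m)" if "m \<ge> 1" for m
    proof (cases "m = 1")
      case True
      then show ?thesis using car1 iota_1 by simp
    next
      case False
      then obtain n where n: "m = Suc n" "n \<ge> 1" using \<open>m \<ge> 1\<close> by (cases m) auto
      have "f n \<in> carrier (gr_rel_n p R G T n)" using f n(2) unfolding mem_gr_rel_iff by auto
      then show ?thesis using fSuc n car by simp
    qed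
    moreover have "iota p R G T f \<in> extensional {1..}" by (simp add: iota_def)
    moreover have "finite {m \<in> {1..}. iota p R G T f m \<noteq> ind (Suc m)}"
    proof (rule finite_subset)
      show "finite (Suc ` {n \<in> {1..}. f n \<noteq> rel (Suc n)})" using f unfolding mem_gr_rel_iff by blast
      show "{m \<in> {1..}. iota p R G T f m \<noteq> ind (Suc m)} \<subseteq> Suc ` {n \<in> {1..}. f n \<noteq> rel (Suc n)}"
      proof
        fix m assume m: "m \<in> {m \<in> {1..}. iota p R G T f m \<noteq> ind (Suc m)}"
        then have "m \<noteq> Suc 0" using iota_1[of f] by (auto simp: numeral_2_eq_2)
        then obtain n where n: "m = Suc n" "n \<ge> 1" using m by (cases m) auto
        then show "m \<in> Suc ` {n \<in> {1..}. f n \<noteq> rel (Suc n)}" using m fSuc[OF n(2)] spec[OF eq, of "Suc n"] by simp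
      qed
    qed
    ultimately show "iota p R G T f \<in> carrier (gr_ind p R G T)"
      unfolding mem_gr_ind_iff by (auto simp: PiE_def)
  qed
  show "carrier (gr_ind p R G T) \<subseteq> iota p R G T ` carrier (gr_rel p R G T)"
  proof
    fix g assume g: "g \<in> carrier (gr_ind p R G T)"
    have gP: "g \<in> (\<Pi>\<^sub>E n\<in>{1..}. carrier (gr_ind_n p R G T n))" and gfin: "finite {n \<in> {1..}. g n \<noteq> ind (Suc n)}"
      using g unfolding mem_gr_ind_iff by blast+
    \<comment> \<open>The inverse shift of \<open>g\<close>; its support is that of \<open>g\<close>
      moved down by one, hence finite.\<close>
    define f where "f = (\<lambda>n\<in>{1..}. g (Suc n))"
    have f: "f \<in> carrier (gr_rel p R G T)"
      unfolding mem_gr_rel_iff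
    proof
      show "f \<in> (\<Pi>\<^sub>E n\<in>{1..}. carrier (gr_rel_n p R G T n))"
        using gP car unfolding f_def by (auto simp: PiE_iff)
      have "Suc ` {n \<in> {1..}. f n \<noteq> rel (Suc n)} \<subseteq> {n \<in> {1..}. g n \<noteq> ind (Suc n)}"
        using eq unfolding f_def by auto
      then show "finite {n \<in> {1..}. f n \<noteq> rel (Suc n)}"
        using gfin by (meson finite_imageD finite_subset inj_Suc inj_on_subset subset_UNIV)
    qed
    have "iota p R G T f = g"
    proof (rule extensionalityI)
      show "iota p R G T f \<in> extensional {1..}" by (simp add: iota_def)
      show "g \<in> extensional {1..}" using gP by (simp add: PiE_def)
      fix m :: nat assume m: "m \<in> {1..}"
      show "iota p R G T f m = g m"
      proof (cases "m = 1")
        case True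
        have "g (Suc 0) \<in> carrier (gr_ind_n p R G T (Suc 0))" using gP by auto
        then show ?thesis using True car1 iota_1 by simp
      next
        case False
        then obtain n where n: "m = Suc n" "n \<ge> 1" using m by (cases m) auto
        then show ?thesis using rel_eq_ind_imp_iota_Suc[OF eq f n(2)] by (simp add: f_def)
      qed
    qed
    then show "g \<in> iota p R G T ` carrier (gr_rel p R G T)" using f by blast
  qed
qed

section \<open>(B) implies (A)\<close>

lemma iota_inj_imp_rel_eq_ind:
  assumes inj: "inj_on (iota p R G T) (carrier (gr_rel p R G T))" and "n \<ge> 1"
  shows "rel n = ind (Suc n)"
  using \<open>n \<ge> 1\<close>
proof (induction n rule: nat_induct_at_least)
  case base
  show ?case using ind_2 by (simp add: numeral_2_eq_2)
next
  case (Suc n)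
  have "ind (Suc (Suc n)) \<subseteq> rel (Suc n)"
  proof
    fix a assume a: "a \<in> ind (Suc (Suc n))"
    then have an: "a \<in> rel n" using Suc.IH p_series_Suc_subset[of "Suc n" p] by auto
    interpret N: normal "rel (Suc n)" G using rel_normal by simp
    interpret I: normal "ind (Suc (Suc n))" G using ind_normal by simp
    have aG: "a \<in> carrier G" using a I.mem_carrier by blast
    let ?f = "\<lambda>b. \<lambda>i\<in>{1..}. if i = n then rel (Suc n) #> b else rel (Suc i)"
    have one: "\<one> \<in> rel n" using subgroup.one_closed[OF normal_imp_subgroup[OF rel_normal[OF Suc.hyps]]] .
    \<comment> \<open>Injectivity is applied to the homogeneous elements of \<open>a\<close> and
      \<open>\<one>\<close> in degree \<open>n\<close>. Their images agree because \<open>a\<close>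
      lies in the denominator \<open>ind (Suc (Suc n))\<close> of the target, and equality of the
      two cosets then means \<open>a \<in> rel (Suc n)\<close>.\<close>
    have "iota p R G T (?f a) = iota p R G T (?f \<one>)"
    proof (rule extensionalityI)
      show "iota p R G T (?f a) \<in> extensional {1..}" "iota p R G T (?f \<one>) \<in> extensional {1..}"
        by (simp_all add: iota_def)
      fix m :: nat assume m: "m \<in> {1..}"
      show "iota p R G T (?f a) m = iota p R G T (?f \<one>) m"
      proof (cases "m = Suc n")
        case True
        have "iota p R G T (?f a) (Suc n) = ind (Suc (Suc n)) #> a"
          using Suc.hyps aG by (intro iota_coset) simp_all
        moreover have "iota p R G T (?f \<one>) (Suc n) = ind (Suc (Suc n)) #> \<one>"
          using Suc.hyps by (intro iota_coset) simp_all
        moreover have "ind (Suc (Suc n)) #> a = ind (Suc (Suc n))" using a I.rcos_const is_group by blast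
        ultimately show ?thesis using True I.subset by simp
      next
        case False
        then show ?thesis using m by (auto simp: iota_def)
      qed
    qed
    then have "?f a = ?f \<one>"
      using inj single_mem_gr_rel[OF Suc.hyps an] single_mem_gr_rel[OF Suc.hyps one] by (auto dest: inj_onD)
    then have "?f a n = ?f \<one> n" by (rule fun_cong)
    then have "rel (Suc n) #> a = rel (Suc n)" using Suc.hyps N.subset by simp
    then show "a \<in> rel (Suc n)" using aG N.r_coset_eq_self_iff by blast
  qed
  then show ?case using rel_subset_ind[of "Suc n"] by (intro subset_antisym) simp_all
qed

section \<open>(C) implies (A)\<close>

lemma iota_surj_imp_factorization:
  assumes surj: "iota p R G T ` carrier (gr_rel p R G T) = carrier (gr_ind p R G T)"
    and n: "n \<ge> 1" and x: "x \<in> ind (Suc n)"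
  obtains e a where "e \<in> ind (Suc (Suc n))" "a \<in> rel n" "x = e \<otimes> a"
proof -
  interpret I: normal "ind (Suc (Suc n))" G using ind_normal by simp
  have xG: "x \<in> carrier G" using x subgroup.mem_carrier[OF normal_imp_subgroup[OF ind_normal]] by auto
  \<comment> \<open>The class of \<open>x\<close> placed in degree \<open>Suc n\<close>. A preimage
    \<open>f\<close> has the class of some \<open>a \<in> rel n\<close> in degree \<open>n\<close>,
    so \<open>x\<close> and \<open>a\<close> agree modulo \<open>ind (Suc (Suc n))\<close>.\<close>
  let ?g = "\<lambda>i\<in>{1..}. if i = Suc n then ind (Suc (Suc n)) #> x else ind (Suc i)"
  have "?g \<in> carrier (gr_ind p R G T)" using single_mem_gr_ind[OF _ x] by simp
  then obtain f where f: "f \<in> carrier (gr_rel p R G T)" "?g = iota p R G T f"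
    using surj by (metis (no_types, lifting) imageE)
  obtain a where a: "a \<in> rel n" "a \<in> carrier G" "f n = rel (Suc n) #> a"
    using gr_rel_component[OF f(1) n] by blast
  have "ind (Suc (Suc n)) #> x = ?g (Suc n)" by simp
  also have "\<dots> = ind (Suc (Suc n)) #> a" unfolding f(2) by (rule iota_coset[where f = f, OF n a(2,3)])
  finally have "x \<in> ind (Suc (Suc n)) #> a" using rcos_self[OF xG I.subgroup_axioms] by simp
  then show thesis using that a(1) unfolding r_coset_def by blast
qed

lemma iota_surj_imp_rel_eq_ind:
  assumes surj: "iota p R G T ` carrier (gr_rel p R G T) = carrier (gr_ind p R G T)" and n: "n \<ge> 1"
  shows "rel n = ind (Suc n)"
proof
  interpret N: normal "rel n" G using rel_normal[OF n] .
  show "ind (Suc n) \<subseteq> rel n"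
  proof (rule subsetI, rule ccontr)
    fix x assume x: "x \<in> ind (Suc n)" and notin: "x \<notin> rel n"
    have xG: "x \<in> carrier G" using x subgroup.mem_carrier[OF normal_imp_subgroup[OF ind_normal]] by auto
    \<comment> \<open>Successive approximation: \<open>x\<close> lies in \<open>rel n\<close> up to
      a factor from arbitrarily deep terms \<open>ind m\<close>.\<close>
    have approx: "\<exists>e\<in>ind m. \<exists>a\<in>rel n. x = e \<otimes> a" if "m \<ge> Suc n" for m
      using that
    proof (induction m rule: nat_induct_at_least)
      case base
      then show ?case using x xG N.one_closed by (intro bexI[of _ x] bexI[of _ \<one>]) simp_all
    next
      case (Suc m)
      obtain e a where e: "e \<in> ind m" and a: "a \<in> rel n" and xea: "x = e \<otimes> a" using Suc.IH by blast
      \<comment> \<open>The factorization of \<open>e \<in> ind m\<close> is the one for index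
        \<open>m - 1\<close>. Its factor \<open>a'\<close> lies in \<open>rel (m - 1)\<close>, which
        is inside \<open>rel n\<close> because \<open>m - 1\<close> is at least
        \<open>n\<close>.\<close>
      have m: "Suc (m - 1) = m" "m - 1 \<ge> 1" using Suc.hyps n by auto
      obtain e' a' where e': "e' \<in> ind (Suc m)" and a': "a' \<in> rel (m - 1)" and ea: "e = e' \<otimes> a'"
        using iota_surj_imp_factorization[OF surj m(2), of e] e m(1) by auto
      have a'n: "a' \<in> rel n"
        using a' rel_p_series_antimono[OF R_normal R_closed n, of "m - 1" p] Suc.hyps by fastforce
      have "e' \<in> carrier G" using e' subgroup.mem_carrier[OF normal_imp_subgroup[OF ind_normal]] by auto
      then have "x = e' \<otimes> (a' \<otimes> a)" using xea ea a a'n by (simp add: m_assoc)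
      then show ?case using e' a a'n by blast
    qed
    obtain U where U: "U \<lhd> G" "openin T U" "x \<notin> U <#> rel n"
      using closed_subgroup_separation[OF N.subgroup_axioms rel_closedin[OF n] xG notin] by blast
    obtain m where m: "m \<ge> 1" "p_series p G T m \<subseteq> U"
      using p_series_eventually_subset[OF U(1,2)] by blast
    \<comment> \<open>The maximum is deep enough for \<open>e\<close> to lie in \<open>U\<close> and
      large enough for \<open>approx\<close> to apply.\<close>
    obtain e a where ea: "e \<in> ind (max m (Suc n))" "a \<in> rel n" "x = e \<otimes> a"
      using approx[of "max m (Suc n)"] by auto
    have "e \<in> U" using ea(1) m p_series_antimono[of m "max m (Suc n)" p] by auto
    then have "x \<in> U <#> rel n" using ea(2,3) unfolding set_mult_def by blast
    then show False using U(3) by blast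
  qed
qed (rule rel_subset_ind[OF n])

end

end

theorem theorem4p2:
  fixes p :: nat
    and G :: "'g monoid" and TG :: "'g topology"
    and S :: "'s monoid" and TS :: "'s topology"
    and R :: "'s set" and \<pi> :: "'s \<Rightarrow> 'g"
  assumes "Factorial_Ring.prime p"
    and "pro_p_group p G TG"
    and "minimal_presentation p R S TS \<pi> G TG"
  shows "((\<forall>n\<ge>1. rel_p_series p R S TS n = R \<inter> p_series p S TS (n + 1)) \<longleftrightarrow>
            inj_on (iota p R S TS) (carrier (gr_rel p R S TS))) \<and>
         (inj_on (iota p R S TS) (carrier (gr_rel p R S TS)) \<longleftrightarrow>
            iota p R S TS ` carrier (gr_rel p R S TS) = carrier (gr_ind p R S TS))"
proof -
  have pro_p_S: "pro_p_group p S TS"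
    using assms(3) by (auto simp: minimal_presentation_def free_pro_p_group_def free_pro_p_on_def)
  have pro_pI: "pro_p H TH p" if "pro_p_group p H TH" for H :: "'h monoid" and TH
    using that assms(1)
    by (simp add: pro_p_def pro_p_axioms_def profinite_def profinite_axioms_def top_group_def
        top_group_axioms_def pro_p_group_def profinite_group_def topological_group_def)
  interpret S: pro_p S TS p by (rule pro_pI[OF pro_p_S])
  interpret G: pro_p G TG p by (rule pro_pI[OF assms(2)])
  obtain X where pres: "\<pi> \<in> hom S G" "continuous_map TS TG \<pi>" "R = kernel S G \<pi>"
      "minimal_generating_set S TS X" "inj_on \<pi> X" "minimal_generating_set G TG (\<pi> ` X)"
    using assms(3) unfolding minimal_presentation_def by blast
  interpret h: group_hom S G \<pi> using pres(1) by unfold_locales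
  have R_normal: "R \<lhd> S" unfolding pres(3) by (rule h.normal_kernel)
  \<comment> \<open>Points are closed in a Hausdorff space, so the kernel is closed as the preimage
    of \<open>\<one>\<close>.\<close>
  have "closedin TG {\<one>\<^bsub>G\<^esub>}"
    using G.profinite_group by (intro closedin_Hausdorff_singleton) (auto simp: profinite_group_def)
  then have R_closed: "closedin TS R"
    using closedin_continuous_map_preimage[OF pres(2)] unfolding pres(3) kernel_def by fastforce
  have R_subset: "R \<subseteq> p_series p S TS 2"
    unfolding pres(3) using pres
    by (intro kernel_subset_p_series_2[OF S.pro_p_axioms G.pro_p_axioms]) (auto simp: minimal_generating_set_def)
  note R = R_normal R_closed R_subset
  show ?thesis
    \<comment> \<open>(A) is equivalent to (B) and to (C) separately; the equivalence of (B) and (C)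
      passes through (A).\<close>
    using S.rel_eq_ind_imp_iota_inj[OF R] S.rel_eq_ind_imp_iota_surj[OF R]
      S.iota_inj_imp_rel_eq_ind[OF R] S.iota_surj_imp_rel_eq_ind[OF R]
    unfolding Suc_eq_plus1[symmetric] by blast
qed

end
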